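(* Let $M$ be an oriented space-like surface in the de Sitter space-time $\mathbb S^4_1(1)\subset\mathbb E^5_1$ with non-zero mean curvature vector $H$ (the mean curvature vector of $M$ in $\mathbb S^4_1(1)$). Then $M$ has pointwise 1-type Gauss map if and only if $H$ is parallel, i.e. $D_XH=0$ for every vector field $X$ tangent to $M$, where $D$ is the normal connection of $M$ in $\mathbb S^4_1(1)$.
   Context: $\mathbb E^5_1$ is $\mathbb R^5$ with the inner product $\langle x,y\rangle=-x_1y_1+x_2y_2+x_3y_3+x_4y_4+x_5y_5$, and $\mathbb S^4_1(1)=\{x\in\mathbb E^5_1:\langle x,x\rangle=1\}$. For a space-like surface $M$ in $\mathbb S^4_1(1)$ (the induced metric is Riemannian), let $h$ and $D$ be its second fundamental form and normal connection in $\mathbb S^4_1(1)$; its mean curvature vector in $\mathbb S^4_1(1)$ is $H=\frac12\,\mathrm{tr}\,h$. The Laplace operator of $M$ is $\Delta=\sum_{i=1}^2(-e_ie_i+\nabla_{e_i}e_i)$ for a local orthonormal tangent frame $\{e_1,e_2\}$, where $\nabla$ is the Levi-Civita connection of $M$. The Gauss map of $M$ is $\nu=e_1\wedge e_2: M\to\Lambda^2(\mathbb E^5_1)$, where $\{e_1,e_2\}$ is a positively oriented local orthonormal tangent frame of $M$, regarded as $\mathbb E^5_1$-valued; $\Delta$ acts on $\nu$ as on a function with values in the vector space $\Lambda^2(\mathbb E^5_1)$. $M$ is said to have pointwise 1-type Gauss map if $\Delta\nu=f(\nu+C)$ for some smooth function $f$ on $M$ and some constant vector $C\in\Lambda^2(\mathbb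 E^5_1)$. *)

theory Defs
  imports "HOL-Analysis.Analysis"
begin

section \<open>Smooth maps and oriented surfaces\<close>

text \<open>Only meaningful for open \<open>S\<close>: differentiability within \<open>S\<close> is then differentiability at
  the points of \<open>S\<close>, which is what \<open>frechet_derivative f (at x)\<close> refers to.\<close>

primrec Ck_on :: "nat \<Rightarrow> 'a::real_normed_vector set \<Rightarrow> ('a \<Rightarrow> 'b::real_normed_vector) \<Rightarrow> bool" where
  "Ck_on 0 S f \<longleftrightarrow> continuous_on S f"
| "Ck_on (Suc k) S f \<longleftrightarrow>
     f differentiable_on S \<and> (\<forall>v. Ck_on k S (\<lambda>x. frechet_derivative f (at x) v))"

definition smooth_on :: "'a::real_normed_vector set \<Rightarrow> ('a \<Rightarrow> 'b::real_normed_vector) \<Rightarrow> bool" where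
  "smooth_on S f \<longleftrightarrow> (\<forall>k. Ck_on k S f)"

type_synonym 'a chart = "'a set \<times> ('a \<Rightarrow> real^2)"

text \<open>An abstract smooth surface is a topological space together with an atlas; it is oriented by
  requiring that the transition maps have positive Jacobian determinant.\<close>

definition oriented_surface :: "'a topology \<Rightarrow> 'a chart set \<Rightarrow> bool" where
  "oriented_surface M A \<longleftrightarrow>
     Hausdorff_space M \<and> second_countable M \<and>
     (\<Union>(U, \<phi>)\<in>A. U) = topspace M \<and>
     (\<forall>(U, \<phi>)\<in>A. openin M U \<and> open (\<phi> ` U) \<and>
        homeomorphic_map (subtopology M U) (top_of_set (\<phi> ` U)) \<phi>) \<and>
     (\<forall>(U, \<phi>)\<in>A. \<forall>(V, \<psi>)\<in>A.
        smooth_on (\<phi> ` (U \<inter> V)) (\<psi> \<circ> inv_into U \<phi>) \<and>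
        (\<forall>p\<in>\<phi> ` (U \<inter> V). det (matrix (frechet_derivative (\<psi> \<circ> inv_into U \<phi>) (at p))) > 0))"

definition smooth_map :: "'a chart set \<Rightarrow> ('a \<Rightarrow> 'b::real_normed_vector) \<Rightarrow> bool" where
  "smooth_map A F \<longleftrightarrow> (\<forall>(U, \<phi>)\<in>A. smooth_on (\<phi> ` U) (F \<circ> inv_into U \<phi>))"


section \<open>Minkowski space, de Sitter space and bivectors\<close>

definition mink :: "real^5 \<Rightarrow> real^5 \<Rightarrow> real" where
  "mink x y = - (x $ 1 * y $ 1) + x $ 2 * y $ 2 + x $ 3 * y $ 3 + x $ 4 * y $ 4 + x $ 5 * y $ 5"

definition de_sitter :: "(real^5) set" where
  "de_sitter = {q. mink q q = 1}"

text \<open>The second exterior power is realised as the space of skew-symmetric matrices, with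
  \<open>u \<and> v\<close> corresponding to \<open>u v\<^sup>T - v u\<^sup>T\<close>.\<close>

definition bivectors :: "(real^5^5) set" where
  "bivectors = {B. transpose B = - B}"

definition wedge :: "real^5 \<Rightarrow> real^5 \<Rightarrow> real^5^5" where
  "wedge u v = (\<chi> i j. u $ i * v $ j - u $ j * v $ i)"


section \<open>Geometry of a parametrized surface in de Sitter space\<close>

text \<open>Here \<open>y\<close> is a local parametrization of the surface by coordinates in \<open>\<real>\<^sup>2\<close>. A tangent
  vector field is given by its components \<open>X :: real^2 \<Rightarrow> real^2\<close> in these coordinates; as a field
  of vectors of the ambient space it is \<open>dird X y\<close>.\<close>

definition dird :: "(real^2 \<Rightarrow> real^2) \<Rightarrow> (real^2 \<Rightarrow> 'b::real_normed_vector) \<Rightarrow> real^2 \<Rightarrow> 'b" where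
  "dird X F p = frechet_derivative F (at p) (X p)"

definition coord_field :: "2 \<Rightarrow> real^2 \<Rightarrow> real^2" where
  "coord_field i p = axis i 1"

definition first_form :: "(real^2 \<Rightarrow> real^5) \<Rightarrow> real^2 \<Rightarrow> real^2 \<Rightarrow> real^2 \<Rightarrow> real" where
  "first_form y p u v = mink (frechet_derivative y (at p) u) (frechet_derivative y (at p) v)"

definition gram :: "(real^2 \<Rightarrow> real^5) \<Rightarrow> real^2 \<Rightarrow> real^2^2" where
  "gram y p = (\<chi> i j. first_form y p (axis i 1) (axis j 1))"

definition christoffel :: "(real^2 \<Rightarrow> real^5) \<Rightarrow> 2 \<Rightarrow> 2 \<Rightarrow> 2 \<Rightarrow> real^2 \<Rightarrow> real" where
  "christoffel y k i j p =
     (\<Sum>l\<in>UNIV. matrix_inv (gram y p) $ k $ l *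
        (dird (coord_field i) (\<lambda>q. gram y q $ j $ l) p
         + dird (coord_field j) (\<lambda>q. gram y q $ i $ l) p
         - dird (coord_field l) (\<lambda>q. gram y q $ i $ j) p)) / 2"

definition levi_civita ::
    "(real^2 \<Rightarrow> real^5) \<Rightarrow> (real^2 \<Rightarrow> real^2) \<Rightarrow> (real^2 \<Rightarrow> real^2) \<Rightarrow> real^2 \<Rightarrow> real^2" where
  "levi_civita y X Y p =
     (\<chi> k. dird X Y p $ k
        + (\<Sum>i\<in>UNIV. \<Sum>j\<in>UNIV. christoffel y k i j p * X p $ i * Y p $ j))"

definition orthonormal_basis :: "(real^2 \<Rightarrow> real^5) \<Rightarrow> real^2 \<Rightarrow> real^2 \<Rightarrow> real^2 \<Rightarrow> bool" where
  "orthonormal_basis y p u v \<longleftrightarrow>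
     first_form y p u u = 1 \<and> first_form y p v v = 1 \<and> first_form y p u v = 0"

definition orthonormal_frame ::
    "(real^2 \<Rightarrow> real^5) \<Rightarrow> (real^2) set \<Rightarrow> (real^2 \<Rightarrow> real^2) \<Rightarrow> (real^2 \<Rightarrow> real^2) \<Rightarrow> bool" where
  "orthonormal_frame y W E\<^sub>1 E\<^sub>2 \<longleftrightarrow>
     smooth_on W E\<^sub>1 \<and> smooth_on W E\<^sub>2 \<and> (\<forall>p\<in>W. orthonormal_basis y p (E\<^sub>1 p) (E\<^sub>2 p))"

definition frame_laplacian ::
    "(real^2 \<Rightarrow> real^5) \<Rightarrow> (real^2 \<Rightarrow> real^2) \<Rightarrow> (real^2 \<Rightarrow> real^2) \<Rightarrow>
     (real^2 \<Rightarrow> 'b::real_normed_vector) \<Rightarrow> real^2 \<Rightarrow> 'b" where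
  "frame_laplacian y E\<^sub>1 E\<^sub>2 F p =
     (- dird E\<^sub>1 (dird E\<^sub>1 F) p + dird (levi_civita y E\<^sub>1 E\<^sub>1) F p)
     + (- dird E\<^sub>2 (dird E\<^sub>2 F) p + dird (levi_civita y E\<^sub>2 E\<^sub>2) F p)"

text \<open>\<open>\<Delta> F = G\<close> on \<open>V\<close>. The Laplacian is independent of the local frame, and local orthonormal
  frames exist around each point, so quantifying over all of them is no restriction.\<close>

definition has_laplacian ::
    "(real^2 \<Rightarrow> real^5) \<Rightarrow> (real^2) set \<Rightarrow> (real^2 \<Rightarrow> 'b::real_normed_vector) \<Rightarrow>
     (real^2 \<Rightarrow> 'b) \<Rightarrow> bool" where
  "has_laplacian y V F G \<longleftrightarrow>
     (\<forall>W E\<^sub>1 E\<^sub>2. open W \<and> W \<subseteq> V \<and> orthonormal_frame y W E\<^sub>1 E\<^sub>2 \<longrightarrow>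
        (\<forall>p\<in>W. frame_laplacian y E\<^sub>1 E\<^sub>2 F p = G p))"

text \<open>The bivector does not depend on the positively oriented orthonormal basis.\<close>

definition gauss_map :: "(real^2 \<Rightarrow> real^5) \<Rightarrow> real^2 \<Rightarrow> real^5^5" where
  "gauss_map y p =
     (THE w. \<exists>u v. orthonormal_basis y p u v \<and> det (vector [u, v] :: real^2^2) > 0 \<and>
        w = wedge (frechet_derivative y (at p) u) (frechet_derivative y (at p) v))"

text \<open>Orthogonal projections onto the tangent plane of the surface and onto its complement.\<close>

definition tangent_part :: "(real^2 \<Rightarrow> real^5) \<Rightarrow> real^2 \<Rightarrow> real^5 \<Rightarrow> real^5" where
  "tangent_part y p w =
     (\<Sum>k\<in>UNIV. \<Sum>l\<in>UNIV.
        (matrix_inv (gram y p) $ k $ l * mink w (dird (coord_field l) y p))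
          *\<^sub>R dird (coord_field k) y p)"

definition normal_part :: "(real^2 \<Rightarrow> real^5) \<Rightarrow> real^2 \<Rightarrow> real^5 \<Rightarrow> real^5" where
  "normal_part y p w = w - tangent_part y p w"

text \<open>The Levi-Civita connection of de Sitter space, acting on fields along \<open>y\<close>: the flat
  derivative followed by the projection along the unit normal of de Sitter space at \<open>y p\<close>,
  which is the position vector \<open>y p\<close> itself.\<close>

definition de_sitter_connection ::
    "(real^2 \<Rightarrow> real^5) \<Rightarrow> (real^2 \<Rightarrow> real^2) \<Rightarrow> (real^2 \<Rightarrow> real^5) \<Rightarrow> real^2 \<Rightarrow> real^5" where
  "de_sitter_connection y X \<xi> p = dird X \<xi> p - mink (dird X \<xi> p) (y p) *\<^sub>R y p"

definition second_form ::
    "(real^2 \<Rightarrow> real^5) \<Rightarrow> (real^2 \<Rightarrow> real^2) \<Rightarrow> (real^2 \<Rightarrow> real^2) \<Rightarrow> real^2 \<Rightarrow> real^5" where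
  "second_form y X Y p = normal_part y p (de_sitter_connection y X (dird Y y) p)"

definition normal_connection ::
    "(real^2 \<Rightarrow> real^5) \<Rightarrow> (real^2 \<Rightarrow> real^2) \<Rightarrow> (real^2 \<Rightarrow> real^5) \<Rightarrow> real^2 \<Rightarrow> real^5" where
  "normal_connection y X \<xi> p = normal_part y p (de_sitter_connection y X \<xi> p)"

definition mean_curvature :: "(real^2 \<Rightarrow> real^5) \<Rightarrow> real^2 \<Rightarrow> real^5" where
  "mean_curvature y p =
     (1/2) *\<^sub>R (\<Sum>i\<in>UNIV. \<Sum>j\<in>UNIV.
        matrix_inv (gram y p) $ i $ j *\<^sub>R second_form y (coord_field i) (coord_field j) p)"


section \<open>Space-like surfaces in de Sitter space\<close>

text \<open>The surface is the (not necessarily injective) image of an abstract oriented surface under a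
  smooth map \<open>x\<close>; positive definiteness of the induced metric makes \<open>x\<close> an immersion. Geometric
  notions are expressed through the parametrizations \<open>x \<circ> \<phi>\<^sup>-\<^sup>1\<close> belonging to the charts \<open>\<phi>\<close>.\<close>

definition spacelike_surface_in_de_sitter ::
    "'a topology \<Rightarrow> 'a chart set \<Rightarrow> ('a \<Rightarrow> real^5) \<Rightarrow> bool" where
  "spacelike_surface_in_de_sitter M A x \<longleftrightarrow>
     oriented_surface M A \<and> smooth_map A x \<and> x ` topspace M \<subseteq> de_sitter \<and>
     (\<forall>(U, \<phi>)\<in>A. \<forall>p\<in>\<phi> ` U. \<forall>u. u \<noteq> 0 \<longrightarrow> first_form (x \<circ> inv_into U \<phi>) p u u > 0)"

definition nonzero_mean_curvature :: "'a chart set \<Rightarrow> ('a \<Rightarrow> real^5) \<Rightarrow> bool" where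
  "nonzero_mean_curvature A x \<longleftrightarrow>
     (\<forall>(U, \<phi>)\<in>A. \<forall>p\<in>\<phi> ` U. mean_curvature (x \<circ> inv_into U \<phi>) p \<noteq> 0)"

definition parallel_mean_curvature :: "'a chart set \<Rightarrow> ('a \<Rightarrow> real^5) \<Rightarrow> bool" where
  "parallel_mean_curvature A x \<longleftrightarrow>
     (\<forall>(U, \<phi>)\<in>A. \<forall>X. smooth_on (\<phi> ` U) X \<longrightarrow>
        (\<forall>p\<in>\<phi> ` U.
           normal_connection (x \<circ> inv_into U \<phi>) X (mean_curvature (x \<circ> inv_into U \<phi>)) p = 0))"

definition pointwise_1_type_gauss_map :: "'a chart set \<Rightarrow> ('a \<Rightarrow> real^5) \<Rightarrow> bool" where
  "pointwise_1_type_gauss_map A x \<longleftrightarrow>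
     (\<exists>f :: 'a \<Rightarrow> real. \<exists>C\<in>bivectors. smooth_map A f \<and>
        (\<forall>(U, \<phi>)\<in>A.
           has_laplacian (x \<circ> inv_into U \<phi>) (\<phi> ` U) (gauss_map (x \<circ> inv_into U \<phi>))
             (\<lambda>p. f (inv_into U \<phi> p) *\<^sub>R (gauss_map (x \<circ> inv_into U \<phi>) p + C))))"

end

theory Submission
  imports Defs
begin

text \<open>For an oriented orthonormal frame the Gauss and Codazzi equations give
  \<open>-\<Delta>\<nu> = 2 D\<^bsub>e\<^sub>1\<^esub>H \<and> e\<^sub>2 + 2 e\<^sub>1 \<and> D\<^bsub>e\<^sub>2\<^esub>H + \<mu> \<nu> + 2 (h\<^sub>1\<^sub>1 - h\<^sub>2\<^sub>2) \<and> h\<^sub>1\<^sub>2\<close>.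

  If \<open>\<Delta>\<nu> = f (\<nu> + C)\<close>, then contracting with the position vector \<open>y\<close> gives \<open>C \<cdot> y = 0\<close> wherever \<open>f \<noteq> 0\<close>,
  hence \<open>C \<cdot> e\<^sub>i = 0\<close> by differentiation, and contracting the equation with \<open>e\<^sub>1\<close> and \<open>e\<^sub>2\<close> leaves \<open>DH = 0\<close>.

  Conversely, if \<open>DH = 0\<close>, the Ricci equation shows that the bivector \<open>(h\<^sub>1\<^sub>1 - h\<^sub>2\<^sub>2) \<and> h\<^sub>1\<^sub>2\<close> is annihilated by
  \<open>y\<close>, \<open>e\<^sub>1\<close>, \<open>e\<^sub>2\<close> and \<open>H \<noteq> 0\<close>, hence vanishes for rank reasons, so that \<open>\<Delta>\<nu> = f \<nu>\<close>. Pairing with \<open>\<nu>\<close> identifies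
  \<open>f\<close> with the squared length of the differential of \<open>\<nu>\<close>, a smooth function independent of the charts.\<close>

section \<open>Calculus of smooth maps\<close>

text \<open>All fields are differentiated in the flat ambient space, where second derivatives
  commute. This symmetry is the only source of the structure equations: one commutator relation for
  a frame, applied in turn to the position vector, the frame vectors and the mean curvature field,
  yields the symmetry of the second fundamental form, the Gauss and Codazzi equations and the Ricci
  equation. The curvature of de Sitter space enters only through position components of the second
  fundamental form, which cancel in \<open>h\<^sub>1\<^sub>1 - h\<^sub>2\<^sub>2\<close> and are
  absent from \<open>h\<^sub>1\<^sub>2\<close>.

  The obstacle in the converse is that the normal plane is Lorentzian: \<open>H\<close> may be
  light-like, and then it cannot be normalised or extended to an orthonormal normal frame. The rank
  argument asks only that \<open>H\<close> be non-zero and orthogonal to \<open>y\<close>,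
  \<open>e\<^sub>1\<close>, \<open>e\<^sub>2\<close>.\<close>

lemma Ck_on_imp_continuous_on: "Ck_on k S f \<Longrightarrow> continuous_on S f"
  by (cases k) (auto intro: differentiable_imp_continuous_on)

lemma Ck_on_SucD: "Ck_on (Suc k) S f \<Longrightarrow> Ck_on k S f"
  by (induction k arbitrary: f) (auto intro: differentiable_imp_continuous_on)

lemma Ck_on_subset: "Ck_on k S f \<Longrightarrow> T \<subseteq> S \<Longrightarrow> Ck_on k T f"
  by (induction k arbitrary: f) (auto intro: continuous_on_subset differentiable_on_subset)

lemma Ck_on_Suc_has_derivative:
  assumes "Ck_on (Suc k) S f" "open S" "x \<in> S"
  shows "(f has_derivative frechet_derivative f (at x)) (at x)"
  using assms by (simp add: differentiable_on_eq_differentiable_at frechet_derivative_works[symmetric])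

lemma Ck_on_cong:
  assumes "open S" "\<And>x. x \<in> S \<Longrightarrow> f x = g x" "Ck_on k S f"
  shows "Ck_on k S g"
  using assms(2,3)
proof (induction k arbitrary: f g)
  case 0
  then show ?case using continuous_on_cong[of S S f g] by simp
next
  case (Suc k)
  have d: "(g has_derivative frechet_derivative f (at x)) (at x)" if "x \<in> S" for x
    using Ck_on_Suc_has_derivative[OF Suc.prems(2) \<open>open S\<close> that] Suc.prems(1) that \<open>open S\<close>
    by (meson has_derivative_transform_within_open)
  then have "g differentiable_on S"
    by (meson differentiable_at_withinI differentiable_def differentiable_on_def)
  moreover have "Ck_on k S (\<lambda>x. frechet_derivative g (at x) v)" for v
  proof (rule Suc.IH)
    show "Ck_on k S (\<lambda>x. frechet_derivative f (at x) v)" using Suc.prems(2) by simp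
  qed (use d frechet_derivative_at in metis)
  ultimately show ?case by simp
qed

text \<open>Derivatives are unique and smoothness on an open set depends only on the values there,
  so any family of derivatives may stand in for \<open>frechet_derivative\<close>. The closure rules
  below rest on this.\<close>

lemma Ck_on_SucI:
  assumes "open S" "\<And>x. x \<in> S \<Longrightarrow> (f has_derivative f' x) (at x)" "\<And>v. Ck_on k S (\<lambda>x. f' x v)"
  shows "Ck_on (Suc k) S f"
proof -
  have "f differentiable_on S"
    using assms(2) by (meson differentiable_at_withinI differentiable_def differentiable_on_def)
  moreover have "Ck_on k S (\<lambda>x. frechet_derivative f (at x) v)" for v
    by (rule Ck_on_cong[OF assms(1) _ assms(3)[of v]]) (use assms(2) frechet_derivative_at in metis)
  ultimately show ?thesis by simp
qed

lemma Ck_on_const: "Ck_on k S (\<lambda>x. c)"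
  by (induction k arbitrary: c) auto

lemma Ck_on_bounded_linear:
  assumes "bounded_linear L" "open S" "Ck_on k S f"
  shows "Ck_on k S (\<lambda>x. L (f x))"
  using assms(3)
proof (induction k arbitrary: f)
  case 0
  then show ?case using bounded_linear.continuous_on[OF assms(1)] by simp
next
  case (Suc k)
  show ?case
    using Suc by (intro Ck_on_SucI[OF assms(2) bounded_linear.has_derivative[OF assms(1)
      Ck_on_Suc_has_derivative[OF Suc.prems assms(2)]]]) auto
qed

lemma Ck_on_add:
  assumes "open S" "Ck_on k S f" "Ck_on k S g"
  shows "Ck_on k S (\<lambda>x. f x + g x)"
  using assms(2,3)
proof (induction k arbitrary: f g)
  case 0
  then show ?case by (simp add: continuous_on_add)
next
  case (Suc k)
  show ?case
    using Suc by (intro Ck_on_SucI[OF assms(1) has_derivative_add[OF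
      Ck_on_Suc_has_derivative[OF Suc.prems(1) assms(1)] Ck_on_Suc_has_derivative[OF Suc.prems(2) assms(1)]]]) auto
qed

lemma Ck_on_bounded_bilinear:
  assumes b: "bounded_bilinear b" and S: "open S" and "Ck_on k S f" "Ck_on k S g"
  shows "Ck_on k S (\<lambda>x. b (f x) (g x))"
  using assms(3,4)
proof (induction k arbitrary: f g)
  case 0
  then show ?case by (simp add: bounded_bilinear.continuous_on[OF b])
next
  case (Suc k)
  have "Ck_on k S f" "Ck_on k S g" using Suc.prems Ck_on_SucD by blast+
  then show ?case
    using Suc S by (intro Ck_on_SucI[OF S bounded_bilinear.FDERIV[OF b
      Ck_on_Suc_has_derivative[OF Suc.prems(1) S] Ck_on_Suc_has_derivative[OF Suc.prems(2) S]]] Ck_on_add) auto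
qed

text \<open>The exponent is generalised in the induction because differentiation lowers it by one.
  Powers supply the normalising factors of the Gram-Schmidt process.\<close>

lemma Ck_on_powr:
  fixes h :: "'a::real_normed_vector \<Rightarrow> real"
  assumes S: "open S" and pos: "\<And>x. x \<in> S \<Longrightarrow> 0 < h x" and "Ck_on k S h"
  shows "Ck_on k S (\<lambda>x. h x powr c)"
  using assms(3)
proof (induction k arbitrary: c)
  case 0
  have "\<And>x. x \<in> S \<Longrightarrow> h x \<noteq> 0" using pos by force
  then show ?case using 0 by (auto intro!: continuous_intros)
next
  case (Suc k)
  have d: "((\<lambda>x. h x powr c) has_derivative
      (\<lambda>v. (c * h x powr (c - 1)) * frechet_derivative h (at x) v)) (at x)" if "x \<in> S" for x
    using has_derivative_powr[OF Ck_on_Suc_has_derivative[OF Suc.prems S that] has_derivative_const[of c]] pos[OF that]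
    by (auto simp: algebra_simps powr_diff)
  have "Ck_on k S h" using Suc.prems Ck_on_SucD by blast
  then show ?case
    using Suc by (intro Ck_on_SucI[OF S d] Ck_on_bounded_bilinear[OF bounded_bilinear_mult S] Ck_on_const) auto
qed

lemma smooth_on_subset: "smooth_on S f \<Longrightarrow> T \<subseteq> S \<Longrightarrow> smooth_on T f"
  by (auto simp: smooth_on_def intro: Ck_on_subset)

lemma smooth_on_cong:
  "open S \<Longrightarrow> (\<And>x. x \<in> S \<Longrightarrow> f x = g x) \<Longrightarrow> smooth_on S f \<Longrightarrow> smooth_on S g"
  unfolding smooth_on_def by (intro allI Ck_on_cong[of S f g]) auto

lemma smooth_on_const: "smooth_on S (\<lambda>x. c)"
  by (simp add: smooth_on_def Ck_on_const)

lemma smooth_on_bounded_linear: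
  "bounded_linear L \<Longrightarrow> open S \<Longrightarrow> smooth_on S f \<Longrightarrow> smooth_on S (\<lambda>x. L (f x))"
  by (simp add: smooth_on_def Ck_on_bounded_linear)

lemma smooth_on_add:
  "open S \<Longrightarrow> smooth_on S f \<Longrightarrow> smooth_on S g \<Longrightarrow> smooth_on S (\<lambda>x. f x + g x)"
  by (simp add: smooth_on_def Ck_on_add)

lemma smooth_on_minus: "open S \<Longrightarrow> smooth_on S f \<Longrightarrow> smooth_on S (\<lambda>x. - f x)"
  by (rule smooth_on_bounded_linear[OF bounded_linear_minus[OF bounded_linear_ident]])

lemma smooth_on_diff:
  "open S \<Longrightarrow> smooth_on S f \<Longrightarrow> smooth_on S g \<Longrightarrow> smooth_on S (\<lambda>x. f x - g x)"
  using smooth_on_add[of S f "\<lambda>x. - g x"] smooth_on_minus[of S g] by simp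

lemma smooth_on_bounded_bilinear:
  "bounded_bilinear b \<Longrightarrow> open S \<Longrightarrow> smooth_on S f \<Longrightarrow> smooth_on S g \<Longrightarrow>
    smooth_on S (\<lambda>x. b (f x) (g x))"
  by (simp add: smooth_on_def Ck_on_bounded_bilinear)

lemmas smooth_on_scaleR = smooth_on_bounded_bilinear[OF bounded_bilinear_scaleR]
lemmas smooth_on_mult = smooth_on_bounded_bilinear[OF bounded_bilinear_mult]
lemmas smooth_on_vec_nth = smooth_on_bounded_linear[OF bounded_linear_vec_nth]

lemma smooth_on_powr:
  fixes h :: "'a::real_normed_vector \<Rightarrow> real"
  shows "open S \<Longrightarrow> (\<And>x. x \<in> S \<Longrightarrow> 0 < h x) \<Longrightarrow> smooth_on S h \<Longrightarrow> smooth_on S (\<lambda>x. h x powr c)"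
  by (simp add: smooth_on_def Ck_on_powr)

lemma smooth_on_frechet_derivative:
  "smooth_on S f \<Longrightarrow> smooth_on S (\<lambda>x. frechet_derivative f (at x) v)"
  unfolding smooth_on_def by (metis Ck_on.simps(2))

lemma smooth_on_has_derivative:
  "smooth_on S f \<Longrightarrow> open S \<Longrightarrow> x \<in> S \<Longrightarrow> (f has_derivative frechet_derivative f (at x)) (at x)"
  unfolding smooth_on_def using Ck_on_Suc_has_derivative by blast

lemma smooth_on_differentiable:
  "smooth_on S f \<Longrightarrow> open S \<Longrightarrow> x \<in> S \<Longrightarrow> f differentiable at x"
  using smooth_on_has_derivative differentiable_def by blast

lemma smooth_on_imp_continuous_on: "smooth_on S f \<Longrightarrow> continuous_on S f"
  unfolding smooth_on_def using Ck_on_imp_continuous_on by blast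

lemma frechet_derivative_linear:
  assumes "f differentiable at x"
  shows "frechet_derivative f (at x) (u + v) = frechet_derivative f (at x) u + frechet_derivative f (at x) v"
    "frechet_derivative f (at x) (u - v) = frechet_derivative f (at x) u - frechet_derivative f (at x) v"
    "frechet_derivative f (at x) (c *\<^sub>R u) = c *\<^sub>R frechet_derivative f (at x) u"
    "frechet_derivative f (at x) 0 = 0"
  using linear_frechet_derivative[OF assms]
  by (auto simp: linear_add linear_diff linear_scale linear_0)

lemma frechet_derivative_expand:
  fixes f :: "real^2 \<Rightarrow> 'b::real_normed_vector"
  assumes "f differentiable at x"
  shows "frechet_derivative f (at x) v =
    v $ 1 *\<^sub>R frechet_derivative f (at x) (axis 1 1) + v $ 2 *\<^sub>R frechet_derivative f (at x) (axis 2 1)"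
proof -
  have "v = v $ 1 *\<^sub>R axis 1 1 + v $ 2 *\<^sub>R axis 2 1"
    by (simp add: vec_eq_iff forall_2 axis_def)
  then show ?thesis
    using frechet_derivative_linear[OF assms] by metis
qed

subsection \<open>Symmetry of second derivatives\<close>

text \<open>Two applications of the mean value theorem to
  \<open>F (p + t u + t v) - F (p + t u) - F (p + t v) + F p\<close>.\<close>

lemma second_difference_mvt:
  fixes F :: "'a::real_normed_vector \<Rightarrow> real"
  assumes sm: "smooth_on (ball p r) F" and t: "0 < t" "t * (norm u + norm v) < r"
  obtains q where "norm (q - p) \<le> t * (norm u + norm v)"
    "F (p + t *\<^sub>R u + t *\<^sub>R v) - F (p + t *\<^sub>R u) - F (p + t *\<^sub>R v) + F p =
      t * t * frechet_derivative (\<lambda>x. frechet_derivative F (at x) u) (at q) v"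
proof -
  define G where "G = (\<lambda>x. frechet_derivative F (at x) u)"
  have G: "smooth_on (ball p r) G"
    unfolding G_def by (rule smooth_on_frechet_derivative[OF sm])
  have le: "norm (s *\<^sub>R u + w *\<^sub>R v) \<le> t * (norm u + norm v)" if "0 \<le> s" "s \<le> t" "0 \<le> w" "w \<le> t" for s w
  proof -
    have "norm (s *\<^sub>R u + w *\<^sub>R v) \<le> s * norm u + w * norm v"
      using norm_triangle_ineq[of "s *\<^sub>R u" "w *\<^sub>R v"] that by simp
    also have "\<dots> \<le> t * norm u + t * norm v"
      using that by (intro add_mono mult_right_mono) auto
    finally show ?thesis by (simp add: algebra_simps)
  qed
  have inb: "p + s *\<^sub>R u + w *\<^sub>R v \<in> ball p r" if "0 \<le> s" "s \<le> t" "0 \<le> w" "w \<le> t" for s w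
  proof -
    have "p - (p + s *\<^sub>R u + w *\<^sub>R v) = - (s *\<^sub>R u + w *\<^sub>R v)" by simp
    then show ?thesis using le[OF that] t by (simp only: mem_ball dist_norm norm_minus_cancel)
  qed
  have inb0: "p + s *\<^sub>R u \<in> ball p r" if "0 \<le> s" "s \<le> t" for s
    using inb[of s 0] that t by simp
  have dF: "((\<lambda>s. F (p + s *\<^sub>R u + w *\<^sub>R v)) has_derivative (\<lambda>h. h * G (p + s *\<^sub>R u + w *\<^sub>R v))) (at s)"
    if "0 \<le> s" "s \<le> t" "0 \<le> w" "w \<le> t" for s w
  proof -
    have line: "((\<lambda>s. p + s *\<^sub>R u + w *\<^sub>R v) has_derivative (\<lambda>h. h *\<^sub>R u)) (at s)"
      by (auto intro!: derivative_eq_intros)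
    have "((\<lambda>s. F (p + s *\<^sub>R u + w *\<^sub>R v)) has_derivative
        (\<lambda>h. frechet_derivative F (at (p + s *\<^sub>R u + w *\<^sub>R v)) (h *\<^sub>R u))) (at s)"
      by (rule has_derivative_compose[OF line smooth_on_has_derivative[OF sm open_ball inb[OF that]]])
    then show ?thesis
      using frechet_derivative_linear(3)[OF smooth_on_differentiable[OF sm open_ball inb[OF that]], of _ u]
      by (simp add: G_def)
  qed
  \<comment> \<open>The inner difference is taken along \<open>v\<close>, so the first mean value
    along \<open>u\<close> leaves a difference of \<open>G\<close> along \<open>v\<close>, ready for
    the second one.\<close>
  define \<phi> where "\<phi> = (\<lambda>s. F (p + s *\<^sub>R u + t *\<^sub>R v) - F (p + s *\<^sub>R u))"
  have d\<phi>: "(\<phi> has_real_derivative G (p + s *\<^sub>R u + t *\<^sub>R v) - G (p + s *\<^sub>R u)) (at s)" if "0 \<le> s" "s \<le> t" for s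
    unfolding \<phi>_def has_field_derivative_def
    using has_derivative_diff[OF dF[of s t] dF[of s 0]] that t
    by (simp add: right_diff_distrib[symmetric] mult_commute_abs)
  obtain s where s: "0 < s" "s < t" "\<phi> t - \<phi> 0 = t * (G (p + s *\<^sub>R u + t *\<^sub>R v) - G (p + s *\<^sub>R u))"
    using MVT2[of 0 t \<phi>, OF t(1) d\<phi>] by auto
  have dG: "((\<lambda>w. G (p + s *\<^sub>R u + w *\<^sub>R v)) has_real_derivative
      frechet_derivative G (at (p + s *\<^sub>R u + w *\<^sub>R v)) v) (at w)" if "0 \<le> w" "w \<le> t" for w
  proof -
    have i: "p + s *\<^sub>R u + w *\<^sub>R v \<in> ball p r" using inb s that by simp
    have line: "((\<lambda>w. p + s *\<^sub>R u + w *\<^sub>R v) has_derivative (\<lambda>h. h *\<^sub>R v)) (at w)"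
      by (auto intro!: derivative_eq_intros)
    have "((\<lambda>w. G (p + s *\<^sub>R u + w *\<^sub>R v)) has_derivative
        (\<lambda>h. frechet_derivative G (at (p + s *\<^sub>R u + w *\<^sub>R v)) (h *\<^sub>R v))) (at w)"
      by (rule has_derivative_compose[OF line smooth_on_has_derivative[OF G open_ball i]])
    then show ?thesis
      using frechet_derivative_linear(3)[OF smooth_on_differentiable[OF G open_ball i], of _ v]
      by (simp add: has_field_derivative_def mult_commute_abs)
  qed
  obtain w where w: "0 < w" "w < t"
    "G (p + s *\<^sub>R u + t *\<^sub>R v) - G (p + s *\<^sub>R u + 0 *\<^sub>R v) = t * frechet_derivative G (at (p + s *\<^sub>R u + w *\<^sub>R v)) v"
    using MVT2[of 0 t "\<lambda>w. G (p + s *\<^sub>R u + w *\<^sub>R v)", OF t(1) dG] by auto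
  show ?thesis
  proof (rule that)
    show "norm (p + s *\<^sub>R u + w *\<^sub>R v - p) \<le> t * (norm u + norm v)"
      using le[of s w] s w by (simp add: add.assoc)
    have "\<phi> t - \<phi> 0 = t * (t * frechet_derivative G (at (p + s *\<^sub>R u + w *\<^sub>R v)) v)"
      using s(3) w(3) by simp
    then show "F (p + t *\<^sub>R u + t *\<^sub>R v) - F (p + t *\<^sub>R u) - F (p + t *\<^sub>R v) + F p =
        t * t * frechet_derivative (\<lambda>x. frechet_derivative F (at x) u) (at (p + s *\<^sub>R u + w *\<^sub>R v)) v"
      by (simp add: \<phi>_def G_def)
  qed
qed

text \<open>Exchanging \<open>u\<close> and \<open>v\<close> does not change the second difference.
  Divided by \<open>t * t\<close> it is therefore a value of either mixed derivative at some point
  near \<open>p\<close>, and both derivatives are continuous.\<close>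

lemma second_derivative_symmetric_real:
  fixes F :: "'a::real_normed_vector \<Rightarrow> real"
  assumes sm: "smooth_on S F" and S: "open S" "p \<in> S"
  shows "frechet_derivative (\<lambda>x. frechet_derivative F (at x) u) (at p) v =
    frechet_derivative (\<lambda>x. frechet_derivative F (at x) v) (at p) u"
proof -
  define P where "P = (\<lambda>q. frechet_derivative (\<lambda>x. frechet_derivative F (at x) u) (at q) v)"
  define Q where "Q = (\<lambda>q. frechet_derivative (\<lambda>x. frechet_derivative F (at x) v) (at q) u)"
  obtain r where r: "r > 0" "ball p r \<subseteq> S" using S open_contains_ball by blast
  have smb: "smooth_on (ball p r) F" using sm r smooth_on_subset by blast
  \<comment> \<open>The summand 1 keeps the denominator positive when \<open>u = v = 0\<close>;
    \<open>n + 2 > 1\<close> keeps all points strictly inside the ball.\<close>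
  define t where "t n = r / (norm u + norm v + 1) / real (n + 2)" for n :: nat
  have n1: "norm u + norm v + 1 > 0" by (simp add: add_nonneg_pos)
  have tp: "t n > 0" for n using r n1 by (simp add: t_def)
  have tb: "t n * (norm u + norm v) < r" for n
  proof -
    have "t n * (norm u + norm v) \<le> r / real (n + 2)"
    proof -
      have "(norm u + norm v) / (norm u + norm v + 1) \<le> 1" using n1 by simp
      then have "r / real (n + 2) * ((norm u + norm v) / (norm u + norm v + 1)) \<le> r / real (n + 2) * 1"
        using r by (intro mult_left_mono) auto
      then show ?thesis by (simp add: t_def field_simps)
    qed
    also have "\<dots> < r" using r by (simp add: field_simps add_pos_nonneg)
    finally show ?thesis .
  qed
  have t0: "(\<lambda>n. t n * (norm u + norm v)) \<longlonglongrightarrow> 0"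
  proof -
    have "(\<lambda>n. 1 / real (n + 2)) \<longlonglongrightarrow> 0"
      using LIMSEQ_ignore_initial_segment[OF lim_1_over_n, of 2] by simp
    from tendsto_mult_left[OF this, of "r / (norm u + norm v + 1) * (norm u + norm v)"]
    show ?thesis by (simp add: t_def field_simps)
  qed
  have "\<exists>q q'. norm (q - p) \<le> t n * (norm u + norm v) \<and> norm (q' - p) \<le> t n * (norm u + norm v) \<and> P q = Q q'" for n
  proof -
    obtain q where q: "norm (q - p) \<le> t n * (norm u + norm v)"
      "F (p + t n *\<^sub>R u + t n *\<^sub>R v) - F (p + t n *\<^sub>R u) - F (p + t n *\<^sub>R v) + F p = t n * t n * P q"
      using second_difference_mvt[OF smb tp tb] unfolding P_def by metis
    have tb': "t n * (norm v + norm u) < r" using tb by (simp add: add.commute)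
    obtain q' where q': "norm (q' - p) \<le> t n * (norm v + norm u)"
      "F (p + t n *\<^sub>R v + t n *\<^sub>R u) - F (p + t n *\<^sub>R v) - F (p + t n *\<^sub>R u) + F p = t n * t n * Q q'"
      using second_difference_mvt[OF smb tp tb'] unfolding Q_def by metis
    have swap: "p + t n *\<^sub>R u + t n *\<^sub>R v = p + t n *\<^sub>R v + t n *\<^sub>R u" by simp
    have "t n * t n * P q = t n * t n * Q q'"
      using q(2) q'(2) unfolding swap by linarith
    then have "P q = Q q'" using tp[of n] by simp
    then show ?thesis using q(1) q'(1) by (auto simp: add.commute)
  qed
  then obtain q q' where qq: "\<And>n. norm (q n - p) \<le> t n * (norm u + norm v)"
      "\<And>n. norm (q' n - p) \<le> t n * (norm u + norm v)" "\<And>n. P (q n) = Q (q' n)"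
    by metis
  have lim: "q \<longlonglongrightarrow> p" "q' \<longlonglongrightarrow> p"
    by (rule LIM_zero_cancel, rule Lim_null_comparison[OF _ t0], use qq(1,2) in simp)+
  have "continuous_on S P" "continuous_on S Q"
    unfolding P_def Q_def using sm
    by (auto intro!: smooth_on_imp_continuous_on smooth_on_frechet_derivative)
  then have "isCont P p" "isCont Q p" using S continuous_on_eq_continuous_at by blast+
  then have "(\<lambda>n. P (q n)) \<longlonglongrightarrow> P p" "(\<lambda>n. Q (q' n)) \<longlonglongrightarrow> Q p"
    using lim by (auto intro: isCont_tendsto_compose)
  then have "P p = Q p" using qq(3) LIMSEQ_unique by auto
  then show ?thesis by (simp add: P_def Q_def)
qed

lemma frechet_derivative_bounded_linear:
  assumes "bounded_linear L" "f differentiable at x"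
  shows "frechet_derivative (\<lambda>x. L (f x)) (at x) v = L (frechet_derivative f (at x) v)"
  using frechet_derivative_at[OF bounded_linear.has_derivative[OF assms(1) assms(2)[unfolded frechet_derivative_works]]]
  by metis

text \<open>The mean value theorem needs real values, hence the passage to the components with
  respect to \<open>Basis\<close>.\<close>

lemma second_derivative_symmetric:
  fixes F :: "'a::real_normed_vector \<Rightarrow> 'b::euclidean_space"
  assumes sm: "smooth_on S F" and S: "open S" "p \<in> S"
  shows "frechet_derivative (\<lambda>x. frechet_derivative F (at x) u) (at p) v =
    frechet_derivative (\<lambda>x. frechet_derivative F (at x) v) (at p) u"
proof (rule euclidean_eqI)
  fix b :: 'b assume "b \<in> Basis"
  note L = bounded_linear_inner_left[of b]
  have *: "frechet_derivative (\<lambda>x. frechet_derivative (\<lambda>x. F x \<bullet> b) (at x) u) (at p) v =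
      frechet_derivative (\<lambda>x. frechet_derivative F (at x) u) (at p) v \<bullet> b" for u v
  proof -
    have "frechet_derivative (\<lambda>x. frechet_derivative (\<lambda>x. F x \<bullet> b) (at x) u) (at p) =
      frechet_derivative (\<lambda>x. frechet_derivative F (at x) u \<bullet> b) (at p)"
      by (rule frechet_derivative_transform_within_open[OF _ S])
        (use sm S in \<open>auto intro!: smooth_on_differentiable smooth_on_frechet_derivative
          smooth_on_bounded_linear[OF L] frechet_derivative_bounded_linear[OF L]\<close>)
    then show ?thesis
      using frechet_derivative_bounded_linear[OF L smooth_on_differentiable[OF smooth_on_frechet_derivative[OF sm] S]]
      by simp
  qed
  show "frechet_derivative (\<lambda>x. frechet_derivative F (at x) u) (at p) v \<bullet> b =
      frechet_derivative (\<lambda>x. frechet_derivative F (at x) v) (at p) u \<bullet> b"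
    using second_derivative_symmetric_real[OF smooth_on_bounded_linear[OF L S(1) sm] S] by (simp add: *)
qed

lemma differentiable_bounded_bilinear:
  "bounded_bilinear b \<Longrightarrow> f differentiable at x \<Longrightarrow> g differentiable at x \<Longrightarrow>
    (\<lambda>x. b (f x) (g x)) differentiable at x"
  unfolding differentiable_def using bounded_bilinear.FDERIV by blast

lemma frechet_derivative_bounded_bilinear:
  assumes "bounded_bilinear b" "f differentiable at x" "g differentiable at x"
  shows "frechet_derivative (\<lambda>x. b (f x) (g x)) (at x) v =
    b (f x) (frechet_derivative g (at x) v) + b (frechet_derivative f (at x) v) (g x)"
  using frechet_derivative_at[OF bounded_bilinear.FDERIV[OF assms(1)
      assms(2)[unfolded frechet_derivative_works] assms(3)[unfolded frechet_derivative_works]]]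
  by metis

lemma frechet_derivative_add:
  assumes "f differentiable at x" "g differentiable at x"
  shows "frechet_derivative (\<lambda>x. f x + g x) (at x) v =
    frechet_derivative f (at x) v + frechet_derivative g (at x) v"
  using frechet_derivative_at[OF has_derivative_add[OF
      assms(1)[unfolded frechet_derivative_works] assms(2)[unfolded frechet_derivative_works]]]
  by metis

section \<open>Hessians and iterated derivatives along vector fields\<close>

definition hess :: "('a::real_normed_vector \<Rightarrow> 'b::real_normed_vector) \<Rightarrow> 'a \<Rightarrow> 'a \<Rightarrow> 'a \<Rightarrow> 'b" where
  "hess F p v w = frechet_derivative (\<lambda>q. frechet_derivative F (at q) w) (at p) v"

lemma hess_commute:
  fixes F :: "'a::real_normed_vector \<Rightarrow> 'b::euclidean_space"
  shows "smooth_on S F \<Longrightarrow> open S \<Longrightarrow> p \<in> S \<Longrightarrow> hess F p v w = hess F p w v"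
  unfolding hess_def by (rule second_derivative_symmetric)

lemma hess_linear_left:
  assumes "smooth_on S F" "open S" "p \<in> S"
  shows "linear (\<lambda>v. hess F p v w)"
  unfolding hess_def using assms
  by (intro linear_frechet_derivative smooth_on_differentiable smooth_on_frechet_derivative)

lemma dird_smooth:
  fixes F :: "real^2 \<Rightarrow> 'b::real_normed_vector"
  assumes S: "open S" and F: "smooth_on S F" and X: "smooth_on S X"
  shows "smooth_on S (dird X F)"
proof (rule smooth_on_cong[OF S])
  show "smooth_on S (\<lambda>q. X q $ 1 *\<^sub>R frechet_derivative F (at q) (axis 1 1)
      + X q $ 2 *\<^sub>R frechet_derivative F (at q) (axis 2 1))"
    by (intro smooth_on_add[OF S] smooth_on_scaleR[OF S] smooth_on_vec_nth[OF S] X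
        smooth_on_frechet_derivative F)
qed (use F S frechet_derivative_expand[of F, symmetric] in \<open>auto simp: dird_def smooth_on_differentiable\<close>)

lemma dird_cong:
  assumes "open S" "p \<in> S" "\<And>q. q \<in> S \<Longrightarrow> F q = G q" "F differentiable at p"
  shows "dird X F p = dird X G p"
  unfolding dird_def using frechet_derivative_transform_within_open[OF assms(4,1,2,3)] by simp

text \<open>Product rule for the derivative of \<open>F\<close> applied to the moving vector
  \<open>Y\<close>. Expanding \<open>Y\<close> in the coordinate directions leaves products of a
  scalar function with a derivative in a fixed direction.\<close>

lemma dird_dird:
  fixes F :: "real^2 \<Rightarrow> 'b::real_normed_vector"
  assumes S: "open S" "p \<in> S" and F: "smooth_on S F" and Y: "smooth_on S Y"
  shows "dird X (dird Y F) p = frechet_derivative F (at p) (dird X Y p) + hess F p (X p) (Y p)"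
proof -
  let ?F = "\<lambda>i q. frechet_derivative F (at q) (axis i 1)"
  have dY: "Y differentiable at p" and dF: "F differentiable at p"
    using Y F S smooth_on_differentiable by blast+
  have dFi: "?F i differentiable at p" for i
    using smooth_on_differentiable[OF smooth_on_frechet_derivative[OF F] S] .
  have dYi: "(\<lambda>q. Y q $ i) differentiable at p" for i
    using smooth_on_differentiable[OF smooth_on_vec_nth[OF S(1) Y] S] .
  have dS: "(\<lambda>q. c q *\<^sub>R ?F i q) differentiable at p" if "c differentiable at p" for c i
    using that dFi by (rule differentiable_scaleR)
  have exp: "frechet_derivative F (at q) w = w $ 1 *\<^sub>R ?F 1 q + w $ 2 *\<^sub>R ?F 2 q" if "q \<in> S" for q w
    using frechet_derivative_expand smooth_on_differentiable[OF F S(1) that] by blast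
  have der: "frechet_derivative (\<lambda>q. c q *\<^sub>R ?F 1 q + d q *\<^sub>R ?F 2 q) (at p) v =
      c p *\<^sub>R hess F p v (axis 1 1) + frechet_derivative c (at p) v *\<^sub>R ?F 1 p
      + (d p *\<^sub>R hess F p v (axis 2 1) + frechet_derivative d (at p) v *\<^sub>R ?F 2 p)"
    if "c differentiable at p" "d differentiable at p" for c d :: "real^2 \<Rightarrow> real" and v
    using that dS dFi
    by (simp add: frechet_derivative_add frechet_derivative_bounded_bilinear[OF bounded_bilinear_scaleR] hess_def)
  have 1: "hess F p v w = w $ 1 *\<^sub>R hess F p v (axis 1 1) + w $ 2 *\<^sub>R hess F p v (axis 2 1)" for v w
  proof -
    have "hess F p v w = frechet_derivative (\<lambda>q. w $ 1 *\<^sub>R ?F 1 q + w $ 2 *\<^sub>R ?F 2 q) (at p) v"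
      unfolding hess_def
      by (rule fun_cong[OF frechet_derivative_transform_within_open[OF
        smooth_on_differentiable[OF smooth_on_frechet_derivative[OF F] S] S exp]])
    then show ?thesis using der[of "\<lambda>_. w $ 1" "\<lambda>_. w $ 2" v] by simp
  qed
  have 2: "frechet_derivative (\<lambda>q. Y q $ i) (at p) v = frechet_derivative Y (at p) v $ i" for i v
    by (rule frechet_derivative_bounded_linear[OF bounded_linear_vec_nth dY])
  have "dird X (dird Y F) p = dird X (\<lambda>q. Y q $ 1 *\<^sub>R ?F 1 q + Y q $ 2 *\<^sub>R ?F 2 q) p"
  proof (rule dird_cong[OF S])
    show "dird Y F q = Y q $ 1 *\<^sub>R ?F 1 q + Y q $ 2 *\<^sub>R ?F 2 q" if "q \<in> S" for q
      unfolding dird_def by (rule exp[OF that])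
    show "dird Y F differentiable at p"
      using smooth_on_differentiable[OF dird_smooth[OF S(1) F Y] S] .
  qed
  also have "\<dots> = frechet_derivative F (at p) (dird X Y p) + hess F p (X p) (Y p)"
    using der[OF dYi[of 1] dYi[of 2], of "X p"] 1[of "X p" "Y p"] exp[OF S(2), of "dird X Y p"]
    by (simp add: dird_def 2)
  finally show ?thesis .
qed

lemma hess_linear_right:
  fixes F :: "'a::real_normed_vector \<Rightarrow> 'b::euclidean_space"
  assumes "smooth_on S F" "open S" "p \<in> S"
  shows "linear (\<lambda>w. hess F p v w)"
  using hess_linear_left[OF assms, of v] hess_commute[OF assms] by (simp add: fun_eq_iff)

text \<open>The Hessian terms cancel by symmetry, which leaves the derivative along the Lie bracket
  of the two fields.\<close>

lemma dird_commutator: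
  fixes F :: "real^2 \<Rightarrow> 'b::euclidean_space"
  assumes S: "open S" "p \<in> S" and F: "smooth_on S F" and X: "smooth_on S X" and Y: "smooth_on S Y"
  shows "dird X (dird Y F) p - dird Y (dird X F) p =
    frechet_derivative F (at p) (dird X Y p - dird Y X p)"
  using dird_dird[OF S F X] dird_dird[OF S F Y] hess_commute[OF F S, of "X p" "Y p"]
    frechet_derivative_linear(2)[OF smooth_on_differentiable[OF F S]]
  by simp

lemma dird_bounded_bilinear:
  assumes "bounded_bilinear b" "F differentiable at p" "G differentiable at p"
  shows "dird X (\<lambda>q. b (F q) (G q)) p = b (F p) (dird X G p) + b (dird X F p) (G p)"
  unfolding dird_def by (rule frechet_derivative_bounded_bilinear[OF assms])

lemma dird_add:
  "F differentiable at p \<Longrightarrow> G differentiable at p \<Longrightarrow>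
    dird X (\<lambda>q. F q + G q) p = dird X F p + dird X G p"
  unfolding dird_def by (rule frechet_derivative_add)

lemma dird_bounded_linear:
  "bounded_linear L \<Longrightarrow> F differentiable at p \<Longrightarrow> dird X (\<lambda>q. L (F q)) p = L (dird X F p)"
  unfolding dird_def by (rule frechet_derivative_bounded_linear)

lemma dird_diff:
  assumes "F differentiable at p" "G differentiable at p"
  shows "dird X (\<lambda>q. F q - G q) p = dird X F p - dird X G p"
  using dird_add[OF assms(1) differentiable_minus[OF assms(2)], of X]
    dird_bounded_linear[OF bounded_linear_minus[OF bounded_linear_ident] assms(2), of X]
  by simp

lemma dird_const [simp]: "dird X (\<lambda>_. c) p = 0"
  by (simp add: dird_def)

lemmas dird_scaleR = dird_bounded_bilinear[OF bounded_bilinear_scaleR]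

section \<open>Minkowski space and bivectors\<close>

lemma exhaust_5:
  fixes x :: 5
  shows "x = 1 \<or> x = 2 \<or> x = 3 \<or> x = 4 \<or> x = 5"
proof (induct x)
  case (of_int z)
  then have "z = 0 \<or> z = 1 \<or> z = 2 \<or> z = 3 \<or> z = 4" by simp arith
  then show ?case by auto
qed

lemma forall_5: "(\<forall>i::5. P i) \<longleftrightarrow> P 1 \<and> P 2 \<and> P 3 \<and> P 4 \<and> P 5"
  by (metis exhaust_5)

lemma bounded_bilinear_mink: "bounded_bilinear mink"
  unfolding bilinear_conv_bounded_bilinear[symmetric] bilinear_def
  by (auto intro!: linearI simp: mink_def algebra_simps)

lemma bounded_bilinear_wedge: "bounded_bilinear wedge"
  unfolding bilinear_conv_bounded_bilinear[symmetric] bilinear_def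
  by (auto intro!: linearI simp: wedge_def vec_eq_iff algebra_simps)

interpretation mink: bounded_bilinear mink by (rule bounded_bilinear_mink)
interpretation wedge: bounded_bilinear wedge by (rule bounded_bilinear_wedge)

lemmas mink_bilinear = mink.add_left mink.add_right mink.diff_left mink.diff_right
  mink.minus_left mink.minus_right mink.scaleR_left mink.scaleR_right mink.zero_left mink.zero_right
lemmas wedge_bilinear = wedge.add_left wedge.add_right wedge.diff_left wedge.diff_right
  wedge.minus_left wedge.minus_right wedge.scaleR_left wedge.scaleR_right wedge.zero_left wedge.zero_right

lemmas dird_mink = dird_bounded_bilinear[OF bounded_bilinear_mink]
lemmas dird_wedge = dird_bounded_bilinear[OF bounded_bilinear_wedge]

lemma mink_commute: "mink u v = mink v u"
  by (simp add: mink_def)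

lemma wedge_commute: "wedge u v = - wedge v u"
  by (simp add: wedge_def vec_eq_iff)

lemma wedge_self [simp]: "wedge u u = 0"
  by (simp add: wedge_def vec_eq_iff)

lemma wedge_in_bivectors: "wedge u v \<in> bivectors"
  by (simp add: bivectors_def wedge_def transpose_def vec_eq_iff)

section \<open>Contraction and inner product of bivectors\<close>

lemma mink_nondegenerate:
  assumes "\<And>w. mink u w = 0"
  shows "u = 0"
  using assms[of "axis 1 1"] assms[of "axis 2 1"] assms[of "axis 3 1"] assms[of "axis 4 1"] assms[of "axis 5 1"]
  by (simp add: mink_def axis_def vec_eq_iff forall_5)

text \<open>The interior product of a bivector with a vector: \<open>mink\<close> lowers the second
  index before it is summed.\<close>

definition contract :: "real^5^5 \<Rightarrow> real^5 \<Rightarrow> real^5" where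
  "contract B w = (\<chi> i. mink (B $ i) w)"

lemma bounded_bilinear_contract: "bounded_bilinear contract"
  unfolding bilinear_conv_bounded_bilinear[symmetric] bilinear_def
  by (auto intro!: linearI simp: contract_def vec_eq_iff mink_bilinear)

interpretation contract: bounded_bilinear contract by (rule bounded_bilinear_contract)

lemmas contract_bilinear = contract.add_left contract.add_right contract.diff_left contract.diff_right
  contract.minus_left contract.minus_right contract.scaleR_left contract.scaleR_right
  contract.zero_left contract.zero_right

lemma contract_wedge: "contract (wedge u v) w = mink v w *\<^sub>R u - mink u w *\<^sub>R v"
  by (simp add: contract_def wedge_def mink_def vec_eq_iff algebra_simps)

lemma contract_skew:
  assumes "B \<in> bivectors"
  shows "mink (contract B u) v = - mink (contract B v) u"
proof -
  have sk: "B $ i $ j = - B $ j $ i" for i j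
  proof -
    have "transpose B $ j $ i = (- B) $ j $ i" using assms by (simp add: bivectors_def)
    then show ?thesis by (simp only: transpose_def vec_lambda_beta vector_uminus_component)
  qed
  have diag: "B $ i $ i = 0" for i
    using sk[of i i] by simp
  show ?thesis
    unfolding contract_def mink_def vec_lambda_beta diag
      sk[of 2 1] sk[of 3 1] sk[of 4 1] sk[of 5 1] sk[of 3 2] sk[of 4 2] sk[of 5 2]
      sk[of 4 3] sk[of 5 3] sk[of 5 4]
    by algebra
qed

text \<open>A skew form has even rank, so it vanishes as soon as its kernel is at least
  four-dimensional.\<close>

lemma bivector_eq_0:
  assumes B: "B \<in> bivectors"
    and k: "contract B a = 0" "contract B b = 0" "contract B c = 0" "contract B d = 0"
    and o: "mink a a = 1" "mink b b = 1" "mink c c = 1" "mink a b = 0" "mink a c = 0" "mink b c = 0"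
      "mink d a = 0" "mink d b = 0" "mink d c = 0" "d \<noteq> 0"
  shows "B = 0"
proof -
  have o': "mink b a = 0" "mink c a = 0" "mink c b = 0" "mink a d = 0" "mink b d = 0" "mink c d = 0"
    using o mink_commute by metis+
  let ?S = "{d, c, b, a}"
  have "a \<noteq> 0" using o by (auto simp: mink.zero_left)
  have nb: "b \<notin> span {a}"
  proof
    assume "b \<in> span {a}"
    then obtain s where "b = s *\<^sub>R a" by (auto simp: span_singleton)
    then have "mink b b = s * mink a b" by (metis mink.scaleR_left real_scaleR_def)
    then show False using o by simp
  qed
  have nc: "c \<notin> span {b, a}"
  proof
    assume "c \<in> span {b, a}"
    then obtain s t where "c = s *\<^sub>R b + t *\<^sub>R a"
      by (auto simp: span_insert span_singleton algebra_simps)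
    then have "mink c c = s * mink b c + t * mink a c" by (metis mink.scaleR_left mink.add_left real_scaleR_def)
    then show False using o by simp
  qed
  \<comment> \<open>\<open>d\<close> may be light-like, so pairing \<open>d\<close> with itself
    would prove nothing. Pairing with \<open>a\<close>, \<open>b\<close>, \<open>c\<close> reads off
    the coefficients and shows that they vanish.\<close>
  have nd: "d \<notin> span {c, b, a}"
  proof
    assume "d \<in> span {c, b, a}"
    then obtain r s t where d: "d = r *\<^sub>R c + s *\<^sub>R b + t *\<^sub>R a"
      by (auto simp: span_insert span_singleton algebra_simps)
    have "r = mink d c" "s = mink d b" "t = mink d a"
      using o o' by (simp_all add: d mink_bilinear)
    then have "r = 0" "s = 0" "t = 0" using o by auto
    then have "d = 0" using d by simp
    then show False using o by simp
  qed
  have ind: "independent ?S"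
    using \<open>a \<noteq> 0\<close> nb nc nd by (simp add: independent_insertI)
  have dist: "a \<noteq> b" "a \<noteq> c" "a \<noteq> d" "b \<noteq> c" "b \<noteq> d" "c \<noteq> d"
    using nb nc nd by (auto intro: span_base)
  have card: "card ?S = 4" using dist by simp
  have "dim (span ?S) = 4" using ind card by (simp add: dim_eq_card_independent)
  then have "span ?S \<noteq> UNIV" using dim_UNIV[where 'a = "real^5"] by force
  then obtain w where w: "w \<notin> span ?S" by blast
  then have "w \<notin> ?S" using span_base[of w ?S] by argo
  then have "card (insert w ?S) = 5" using card by simp
  moreover have "independent (insert w ?S)" using w ind by (rule independent_insertI)
  moreover have "dim (UNIV :: (real^5) set) = 5" by simp
  ultimately have "UNIV \<subseteq> span (insert w ?S)"
    by (intro card_ge_dim_independent) (simp_all only: subset_UNIV order_refl not_False_eq_True)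
  then have ex: "\<exists>s. v - s *\<^sub>R w \<in> span ?S" for v by (auto simp: span_insert[of w])
  have ker: "contract B s = 0" if "s \<in> span ?S" for s
    using that
  proof (induction rule: span_induct)
    case base
    then show ?case by (auto simp: subspace_def contract_bilinear)
  next
    case (step x)
    then show ?case using k by auto
  qed
  \<comment> \<open>\<open>w\<close> complements the kernel vectors to the whole space. Pairings of
    \<open>contract B w\<close> with kernel vectors vanish by skewness, the one with
    \<open>w\<close> because the form is alternating.\<close>
  have w0: "mink (contract B w) w = 0" using contract_skew[OF B, of w w] by simp
  have "mink (contract B w) v = 0" for v
  proof -
    obtain s where s: "v - s *\<^sub>R w \<in> span ?S" using ex by blast
    have "mink (contract B w) (v - s *\<^sub>R w) = 0"
      using contract_skew[OF B] ker[OF s] by (simp add: mink.zero_left)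
    then show ?thesis using w0 by (simp add: mink_bilinear)
  qed
  then have cw: "contract B w = 0" by (rule mink_nondegenerate)
  have cv: "contract B v = 0" for v
  proof -
    obtain s where "v - s *\<^sub>R w \<in> span ?S" using ex by blast
    from ker[OF this] show ?thesis using cw by (simp add: contract_bilinear)
  qed
  then have "mink (B $ i) v = 0" for i v by (simp add: contract_def vec_eq_iff)
  then have "B $ i = 0" for i using mink_nondegenerate by blast
  then show "B = 0" by (simp add: vec_eq_iff)
qed

text \<open>The metric induced on bivectors. The sign of the first row lowers the first index,
  \<open>mink\<close> lowers the second, and the factor 1/2 compensates for counting every pair of
  indices twice.\<close>

definition biv_inner :: "real^5^5 \<Rightarrow> real^5^5 \<Rightarrow> real" where
  "biv_inner S T = (- mink (S $ 1) (T $ 1) + mink (S $ 2) (T $ 2) + mink (S $ 3) (T $ 3)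
     + mink (S $ 4) (T $ 4) + mink (S $ 5) (T $ 5)) / 2"

lemma bounded_bilinear_biv_inner: "bounded_bilinear biv_inner"
  unfolding bilinear_conv_bounded_bilinear[symmetric] bilinear_def
  by (auto intro!: linearI simp: biv_inner_def mink_bilinear field_simps)

interpretation biv_inner: bounded_bilinear biv_inner by (rule bounded_bilinear_biv_inner)

lemmas dird_biv_inner = dird_bounded_bilinear[OF bounded_bilinear_biv_inner]

lemma biv_inner_commute: "biv_inner S T = biv_inner T S"
  by (simp add: biv_inner_def mink_commute)

lemma biv_inner_wedge:
  "biv_inner (wedge a b) (wedge c d) = mink a c * mink b d - mink a d * mink b c"
proof -
  have nth: "wedge a b $ i = a $ i *\<^sub>R b - b $ i *\<^sub>R a" for a b i
    by (simp add: wedge_def vec_eq_iff)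
  have "biv_inner (wedge a b) (wedge c d) =
     (mink a c * mink b d - mink a d * mink b c - mink b c * mink a d + mink b d * mink a c) / 2"
    unfolding biv_inner_def nth mink_bilinear
    by (simp add: mink_def[of a c] mink_def[of a d] mink_def[of b c] mink_def[of b d] algebra_simps)
  then show ?thesis by simp
qed

section \<open>Surfaces with an orthonormal frame\<close>

lemma matrix_inv_unique:
  fixes A B :: "real^'n^'n"
  assumes "A ** B = mat 1"
  shows "matrix_inv A = B"
proof -
  have "invertible A" using assms invertible_right_inverse by blast
  then have "matrix_inv A ** A = mat 1"
    unfolding matrix_inv_def invertible_def by (rule someI2_ex) blast
  then have "matrix_inv A = matrix_inv A ** (A ** B)" using assms by simp
  also have "\<dots> = B" using \<open>matrix_inv A ** A = mat 1\<close> by (simp add: matrix_mul_assoc)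
  finally show ?thesis .
qed

lemma first_form_commute: "first_form y p u v = first_form y p v u"
  by (simp add: first_form_def mink_commute)

lemma first_form_bilinear:
  assumes "y differentiable at p"
  shows "first_form y p (u + v) w = first_form y p u w + first_form y p v w"
    "first_form y p w (u + v) = first_form y p w u + first_form y p w v"
    "first_form y p (c *\<^sub>R u) w = c * first_form y p u w"
    "first_form y p w (c *\<^sub>R u) = c * first_form y p w u"
  by (simp_all add: first_form_def frechet_derivative_linear[OF assms] mink_bilinear)

lemma first_form_gram:
  assumes "y differentiable at p"
  shows "first_form y p u v = (\<Sum>i\<in>UNIV. \<Sum>j\<in>UNIV. u $ i * gram y p $ i $ j * v $ j)"
proof -
  have "first_form y p u v = first_form y p (u $ 1 *\<^sub>R axis 1 1 + u $ 2 *\<^sub>R axis 2 1) (v $ 1 *\<^sub>R axis 1 1 + v $ 2 *\<^sub>R axis 2 1)"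
    by (rule arg_cong2[where f = "first_form y p"]) (simp_all add: vec_eq_iff forall_2 axis_def)
  then show ?thesis
    by (simp add: first_form_bilinear[OF assms] sum_2 gram_def algebra_simps)
qed

context
  fixes y :: "real^2 \<Rightarrow> real^5" and p u v
  assumes dy: "y differentiable at p" and ob: "orthonormal_basis y p u v"
begin

text \<open>\<open>P\<close> has the columns \<open>u\<close> and \<open>v\<close>, and
  orthonormality says that \<open>transpose P ** gram y p\<close> is a left inverse of
  \<open>P\<close>. For square matrices it is then also a right inverse, so
  \<open>P ** transpose P\<close> inverts the Gram matrix.\<close>

lemma orthonormal_gram:
  defines "P \<equiv> (\<chi> k i. if i = 1 then u $ k else v $ k) :: real^2^2"
  shows "P ** (transpose P ** gram y p) = mat 1" "gram y p ** (P ** transpose P) = mat 1" "det P \<noteq> 0"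
proof -
  have "first_form y p u u = 1" "first_form y p v v = 1" "first_form y p u v = 0" "first_form y p v u = 0"
    using ob by (auto simp: orthonormal_basis_def first_form_commute[of y p v u])
  then have "(transpose P ** gram y p) ** P = mat 1"
    unfolding first_form_gram[OF dy]
    by (simp add: vec_eq_iff forall_2 matrix_matrix_mult_def transpose_def P_def mat_def sum_2 algebra_simps)
  then show 1: "P ** (transpose P ** gram y p) = mat 1" using matrix_left_right_inverse by blast
  then show "gram y p ** (P ** transpose P) = mat 1"
    by (metis matrix_left_right_inverse matrix_mul_assoc)
  have "det P * det (transpose P ** gram y p) = 1" using 1 by (metis det_I det_mul)
  then show "det P \<noteq> 0" by auto
qed

text \<open>This converts every trace taken with the inverse metric in coordinates into a sum over
  the orthonormal basis.\<close>

lemma matrix_inv_gram: "matrix_inv (gram y p) $ k $ l = u $ k * u $ l + v $ k * v $ l"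
  unfolding matrix_inv_unique[OF orthonormal_gram(2)]
  by (simp add: matrix_matrix_mult_def transpose_def sum_2)

lemma orthonormal_det: "det (vector [u, v] :: real^2^2) \<noteq> 0"
  using orthonormal_gram(3) by (simp add: det_2 vector_2 algebra_simps)

lemma orthonormal_expand: "w = first_form y p w u *\<^sub>R u + first_form y p w v *\<^sub>R v"
proof -
  define P where "P = ((\<chi> k i. if i = 1 then u $ k else v $ k) :: real^2^2)"
  have "w = (P ** (transpose P ** gram y p)) *v w"
    using orthonormal_gram(1) by (simp add: P_def)
  also have "\<dots> = first_form y p u w *\<^sub>R u + first_form y p v w *\<^sub>R v"
    unfolding first_form_gram[OF dy]
    by (simp add: vec_eq_iff forall_2 matrix_matrix_mult_def matrix_vector_mult_def transpose_def P_def sum_2 algebra_simps)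
  finally show ?thesis by (simp add: first_form_commute[of y p w])
qed

lemma tangent_part_orthonormal:
  "tangent_part y p w = mink w (frechet_derivative y (at p) u) *\<^sub>R frechet_derivative y (at p) u
     + mink w (frechet_derivative y (at p) v) *\<^sub>R frechet_derivative y (at p) v"
  unfolding frechet_derivative_expand[OF dy, of u] frechet_derivative_expand[OF dy, of v]
  by (simp add: tangent_part_def matrix_inv_gram dird_def coord_field_def sum_2 mink_bilinear
      scaleR_add_left scaleR_add_right algebra_simps)

lemma frechet_derivative_inj:
  assumes "frechet_derivative y (at p) w = frechet_derivative y (at p) z"
  shows "w = z"
  using orthonormal_expand[of w] orthonormal_expand[of z] assms by (simp add: first_form_def)

lemma tangent_part_tangent: "tangent_part y p (frechet_derivative y (at p) w) = frechet_derivative y (at p) w"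
proof -
  have "frechet_derivative y (at p) w = frechet_derivative y (at p) (first_form y p w u *\<^sub>R u + first_form y p w v *\<^sub>R v)"
    using orthonormal_expand[of w] by simp
  then show ?thesis
    by (simp add: tangent_part_orthonormal frechet_derivative_linear[OF dy] first_form_def)
qed

end

section \<open>Projections, Levi-Civita connection and mean curvature\<close>

lemma tangent_part_add: "tangent_part y p (v + w) = tangent_part y p v + tangent_part y p w"
  by (simp add: tangent_part_def sum_2 mink_bilinear algebra_simps)

lemma tangent_part_scaleR: "tangent_part y p (c *\<^sub>R w) = c *\<^sub>R tangent_part y p w"
  by (simp add: tangent_part_def sum_2 mink_bilinear algebra_simps)

lemma normal_part_add: "normal_part y p (v + w) = normal_part y p v + normal_part y p w"
  by (simp add: normal_part_def tangent_part_add)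

lemma normal_part_scaleR: "normal_part y p (c *\<^sub>R w) = c *\<^sub>R normal_part y p w"
  by (simp add: normal_part_def tangent_part_scaleR algebra_simps)

lemma normal_part_diff: "normal_part y p (v - w) = normal_part y p v - normal_part y p w"
  using normal_part_add[of y p v "- w"] normal_part_scaleR[of y p "- 1" w] by simp

text \<open>The metric comes from a flat space, so its derivatives are given by the product rule; by
  symmetry of the Hessian four of the six resulting terms cancel, and the other two are
  equal.\<close>

lemma koszul_formula:
  assumes S: "open S" "p \<in> S" and y: "smooth_on S y"
  shows "(\<Sum>k\<in>UNIV. christoffel y k i j p *\<^sub>R frechet_derivative y (at p) (axis k 1)) =
    tangent_part y p (hess y p (axis i 1) (axis j 1))"
proof -
  have dyi: "(\<lambda>q. frechet_derivative y (at q) (axis i 1)) differentiable at p" for i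
    using smooth_on_differentiable[OF smooth_on_frechet_derivative[OF y] S] .
  have dg: "dird (coord_field i) (\<lambda>q. gram y q $ j $ l) p =
      mink (frechet_derivative y (at p) (axis j 1)) (hess y p (axis i 1) (axis l 1))
      + mink (hess y p (axis i 1) (axis j 1)) (frechet_derivative y (at p) (axis l 1))" for i j l
    unfolding gram_def first_form_def vec_lambda_beta dird_mink[OF dyi dyi]
    by (simp add: dird_def coord_field_def hess_def)
  have "dird (coord_field i) (\<lambda>q. gram y q $ j $ l) p + dird (coord_field j) (\<lambda>q. gram y q $ i $ l) p
      - dird (coord_field l) (\<lambda>q. gram y q $ i $ j) p =
      2 * mink (hess y p (axis i 1) (axis j 1)) (frechet_derivative y (at p) (axis l 1))" for l
    using hess_commute[OF y S, of "axis j 1" "axis i 1"] hess_commute[OF y S, of "axis l 1" "axis i 1"]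
      hess_commute[OF y S, of "axis l 1" "axis j 1"]
    by (simp add: dg mink_commute)
  then have "christoffel y k i j p = (\<Sum>l\<in>UNIV. matrix_inv (gram y p) $ k $ l *
      mink (hess y p (axis i 1) (axis j 1)) (frechet_derivative y (at p) (axis l 1)))" for k
    by (simp add: christoffel_def sum_2)
  then show ?thesis
    by (simp add: tangent_part_def dird_def coord_field_def sum_2 scaleR_add_left)
qed

lemma hess_expand:
  fixes F :: "real^2 \<Rightarrow> 'b::euclidean_space"
  assumes "smooth_on S F" "open S" "p \<in> S"
  shows "hess F p v w = (\<Sum>i\<in>UNIV. \<Sum>j\<in>UNIV. (v $ i * w $ j) *\<^sub>R hess F p (axis i 1) (axis j 1))"
proof -
  note l = hess_linear_left[OF assms] and r = hess_linear_right[OF assms]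
  have "hess F p v w = hess F p (v $ 1 *\<^sub>R axis 1 1 + v $ 2 *\<^sub>R axis 2 1) (w $ 1 *\<^sub>R axis 1 1 + w $ 2 *\<^sub>R axis 2 1)"
    by (rule arg_cong2[where f = "hess F p"]) (simp_all add: vec_eq_iff forall_2 axis_def)
  then show ?thesis
    by (simp add: linear_add[OF l] linear_add[OF r] linear_scale[OF l] linear_scale[OF r] sum_2 algebra_simps)
qed

text \<open>Gauss formula: the derivative of the components of \<open>Y\<close> is already tangent,
  and the Christoffel terms account for the tangent part of the Hessian.\<close>

lemma frechet_derivative_levi_civita:
  assumes S: "open S" "p \<in> S" and y: "smooth_on S y" and Y: "smooth_on S Y"
    and ob: "orthonormal_basis y p u v"
  shows "frechet_derivative y (at p) (levi_civita y X Y p) = tangent_part y p (dird X (dird Y y) p)"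
proof -
  note dy = smooth_on_differentiable[OF y S]
  let ?c = "\<lambda>k. \<Sum>i\<in>UNIV. \<Sum>j\<in>UNIV. christoffel y k i j p * X p $ i * Y p $ j"
  have "levi_civita y X Y p = dird X Y p + (\<chi> k. ?c k)"
    by (simp add: levi_civita_def vec_eq_iff)
  then have "frechet_derivative y (at p) (levi_civita y X Y p) =
      frechet_derivative y (at p) (dird X Y p) + frechet_derivative y (at p) (\<chi> k. ?c k)"
    by (simp add: frechet_derivative_linear[OF dy])
  also have "frechet_derivative y (at p) (\<chi> k. ?c k) =
      (\<Sum>k\<in>UNIV. ?c k *\<^sub>R frechet_derivative y (at p) (axis k 1))"
    by (subst frechet_derivative_expand[OF dy]) (simp add: sum_2)
  also have "\<dots> = (\<Sum>i\<in>UNIV. \<Sum>j\<in>UNIV. (X p $ i * Y p $ j) *\<^sub>R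
      (\<Sum>k\<in>UNIV. christoffel y k i j p *\<^sub>R frechet_derivative y (at p) (axis k 1)))"
    by (simp add: sum_2 algebra_simps)
  also have "\<dots> = tangent_part y p (hess y p (X p) (Y p))"
    unfolding koszul_formula[OF S y] hess_expand[OF y S, of "X p"]
    by (simp add: sum_2 tangent_part_add tangent_part_scaleR)
  finally show ?thesis
    unfolding dird_dird[OF S y Y] by (simp add: tangent_part_add tangent_part_tangent[OF dy ob])
qed

lemma mean_curvature_orthonormal:
  assumes S: "open S" "p \<in> S" and y: "smooth_on S y" and ob: "orthonormal_basis y p u v"
  shows "mean_curvature y p = (1/2) *\<^sub>R normal_part y p
    (hess y p u u - mink (hess y p u u) (y p) *\<^sub>R y p + (hess y p v v - mink (hess y p v v) (y p) *\<^sub>R y p))"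
proof -
  note dy = smooth_on_differentiable[OF y S]
  have "second_form y (coord_field i) (coord_field j) p = normal_part y p
     (hess y p (axis i 1) (axis j 1) - mink (hess y p (axis i 1) (axis j 1)) (y p) *\<^sub>R y p)" for i j
  proof -
    have "smooth_on S (coord_field j)" unfolding coord_field_def by (rule smooth_on_const)
    moreover have "dird (coord_field i) (coord_field j) p = 0"
      unfolding coord_field_def[of j, abs_def] by simp
    ultimately have "dird (coord_field i) (dird (coord_field j) y) p = hess y p (axis i 1) (axis j 1)"
      using dird_dird[OF S y, of "coord_field j" "coord_field i"]
      by (simp add: frechet_derivative_linear[OF dy] coord_field_def)
    then show ?thesis by (simp add: second_form_def de_sitter_connection_def)
  qed
  \<comment> \<open>\<open>N\<close> is linear, so the coordinate trace against the inverse Gram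
    matrix can be regrouped into a sum over the orthonormal basis.\<close>
  moreover define N where "N h = normal_part y p (h - mink h (y p) *\<^sub>R y p)" for h
  ultimately have "second_form y (coord_field i) (coord_field j) p = N (hess y p (axis i 1) (axis j 1))" for i j
    by simp
  moreover have N: "N (g + h) = N g + N h" "N (c *\<^sub>R h) = c *\<^sub>R N h" for g h c
    by (simp_all add: N_def mink_bilinear normal_part_add normal_part_diff normal_part_scaleR algebra_simps)
  ultimately have "mean_curvature y p = (1/2) *\<^sub>R (N (hess y p u u) + N (hess y p v v))"
    unfolding mean_curvature_def hess_expand[OF y S, of u] hess_expand[OF y S, of v]
    by (simp add: matrix_inv_gram[OF dy ob] sum_2 algebra_simps)
  then show ?thesis by (simp add: N_def normal_part_add)
qed

section \<open>Moving frames and structure equations\<close>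

locale surface_frame =
  fixes y :: "real^2 \<Rightarrow> real^5" and W :: "(real^2) set" and E\<^sub>1 E\<^sub>2 :: "real^2 \<Rightarrow> real^2"
  assumes open_W: "open W" and smooth_y: "smooth_on W y"
    and frame: "orthonormal_frame y W E\<^sub>1 E\<^sub>2"
    and sphere: "p \<in> W \<Longrightarrow> mink (y p) (y p) = 1"
begin

text \<open>\<open>A\<^sub>i\<^sub>j\<close> and \<open>H\<close> are taken in Minkowski space: \<open>A\<^sub>i\<^sub>j\<close> is the second fundamental form of the surface in
  de Sitter space minus \<open>\<delta>\<^sub>i\<^sub>j y\<close>, and \<open>H\<close> is the mean curvature vector in de Sitter space minus \<open>y\<close>.\<close>

abbreviation "e\<^sub>1 \<equiv> dird E\<^sub>1 y"
abbreviation "e\<^sub>2 \<equiv> dird E\<^sub>2 y"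

text \<open>\<open>a\<close> and \<open>b\<close> are the values on \<open>E\<^sub>1\<close> and
  \<open>E\<^sub>2\<close> of the connection form of the frame.\<close>

definition a :: "real^2 \<Rightarrow> real" where "a q = mink (dird E\<^sub>1 e\<^sub>1 q) (e\<^sub>2 q)"
definition b :: "real^2 \<Rightarrow> real" where "b q = mink (dird E\<^sub>2 e\<^sub>1 q) (e\<^sub>2 q)"
definition A\<^sub>1\<^sub>1 :: "real^2 \<Rightarrow> real^5" where "A\<^sub>1\<^sub>1 q = dird E\<^sub>1 e\<^sub>1 q - a q *\<^sub>R e\<^sub>2 q"
definition A\<^sub>1\<^sub>2 :: "real^2 \<Rightarrow> real^5" where "A\<^sub>1\<^sub>2 q = dird E\<^sub>1 e\<^sub>2 q + a q *\<^sub>R e\<^sub>1 q"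
definition A\<^sub>2\<^sub>2 :: "real^2 \<Rightarrow> real^5" where "A\<^sub>2\<^sub>2 q = dird E\<^sub>2 e\<^sub>2 q + b q *\<^sub>R e\<^sub>1 q"
definition H :: "real^2 \<Rightarrow> real^5" where "H q = (1/2) *\<^sub>R (A\<^sub>1\<^sub>1 q + A\<^sub>2\<^sub>2 q)"
definition \<nu> :: "real^2 \<Rightarrow> real^5^5" where "\<nu> q = wedge (e\<^sub>1 q) (e\<^sub>2 q)"

lemma smooth_E: "smooth_on W E\<^sub>1" "smooth_on W E\<^sub>2"
  using frame by (auto simp: orthonormal_frame_def)

lemma basis: "p \<in> W \<Longrightarrow> orthonormal_basis y p (E\<^sub>1 p) (E\<^sub>2 p)"
  using frame by (auto simp: orthonormal_frame_def)

lemma smooth_dird [intro]: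
  "smooth_on W F \<Longrightarrow> smooth_on W (dird E\<^sub>1 F)" "smooth_on W F \<Longrightarrow> smooth_on W (dird E\<^sub>2 F)"
  using dird_smooth open_W smooth_E by blast+

lemma smooth_e: "smooth_on W e\<^sub>1" "smooth_on W e\<^sub>2"
  using smooth_y by auto

lemma smooth_ab: "smooth_on W a" "smooth_on W b"
  unfolding a_def[abs_def] b_def[abs_def]
  by (intro smooth_on_bounded_bilinear[OF bounded_bilinear_mink open_W] smooth_dird smooth_e)+

lemma smooth_A: "smooth_on W A\<^sub>1\<^sub>1" "smooth_on W A\<^sub>1\<^sub>2" "smooth_on W A\<^sub>2\<^sub>2"
  unfolding A\<^sub>1\<^sub>1_def[abs_def] A\<^sub>1\<^sub>2_def[abs_def] A\<^sub>2\<^sub>2_def[abs_def]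
  by (intro smooth_on_add[OF open_W] smooth_on_diff[OF open_W] smooth_on_scaleR[OF open_W]
      smooth_dird smooth_e smooth_ab)+

lemma smooth_H: "smooth_on W H"
  unfolding H_def[abs_def]
  by (intro smooth_on_bounded_linear[OF bounded_linear_scaleR_right open_W] smooth_on_add[OF open_W] smooth_A)

lemma smooth_nu: "smooth_on W \<nu>"
  unfolding \<nu>_def[abs_def]
  by (intro smooth_on_bounded_bilinear[OF bounded_bilinear_wedge open_W] smooth_e)

lemma differentiable_W: "smooth_on W F \<Longrightarrow> p \<in> W \<Longrightarrow> F differentiable at p"
  using smooth_on_differentiable open_W by blast

lemmas differentiable_fields =
  differentiable_W[OF smooth_y] smooth_e[THEN differentiable_W] smooth_ab[THEN differentiable_W]
  smooth_A[THEN differentiable_W] differentiable_W[OF smooth_H] differentiable_W[OF smooth_nu]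

lemma dird_W_cong:
  "p \<in> W \<Longrightarrow> (\<And>q. q \<in> W \<Longrightarrow> F q = G q) \<Longrightarrow> smooth_on W F \<Longrightarrow> dird X F p = dird X G p"
  by (rule dird_cong[OF open_W]) (auto intro: differentiable_W)

text \<open>Source of all relations between the frame, the position vector, the normal fields and
  their derivatives: a constant inner product is differentiated.\<close>

lemma dird_mink_const:
  assumes p: "p \<in> W" and F: "smooth_on W F" and G: "smooth_on W G"
    and c: "\<And>q. q \<in> W \<Longrightarrow> mink (F q) (G q) = c"
  shows "mink (F p) (dird X G p) = - mink (dird X F p) (G p)"
proof -
  have "dird X (\<lambda>q. mink (F q) (G q)) p = dird X (\<lambda>q. c) p"
    by (rule dird_W_cong[OF p c smooth_on_bounded_bilinear[OF bounded_bilinear_mink open_W F G]])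
  then show ?thesis using dird_mink[OF F[THEN differentiable_W, OF p] G[THEN differentiable_W, OF p], of X] by simp
qed

lemma e_orthonormal:
  assumes "q \<in> W"
  shows "mink (e\<^sub>1 q) (e\<^sub>1 q) = 1" "mink (e\<^sub>2 q) (e\<^sub>2 q) = 1" "mink (e\<^sub>1 q) (e\<^sub>2 q) = 0" "mink (e\<^sub>2 q) (e\<^sub>1 q) = 0"
  using basis[OF assms] by (auto simp: orthonormal_basis_def first_form_def dird_def mink_commute)

lemma y_normal:
  assumes "q \<in> W"
  shows "mink (y q) (dird X y q) = 0" "mink (dird X y q) (y q) = 0"
  using dird_mink_const[OF assms smooth_y smooth_y sphere, of X] mink_commute[of "y q" "dird X y q"] by auto

lemma dird_e_tangent:
  assumes q: "q \<in> W"
  shows "mink (dird X e\<^sub>1 q) (e\<^sub>1 q) = 0" "mink (dird X e\<^sub>2 q) (e\<^sub>2 q) = 0"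
    "mink (dird X e\<^sub>2 q) (e\<^sub>1 q) = - mink (dird X e\<^sub>1 q) (e\<^sub>2 q)"
    "mink (dird X e\<^sub>1 q) (y q) = - mink (e\<^sub>1 q) (dird X y q)"
    "mink (dird X e\<^sub>2 q) (y q) = - mink (e\<^sub>2 q) (dird X y q)"
  using dird_mink_const[OF q smooth_e(1) smooth_e(1) e_orthonormal(1), of X]
    dird_mink_const[OF q smooth_e(2) smooth_e(2) e_orthonormal(2), of X]
    dird_mink_const[OF q smooth_e(1) smooth_e(2) e_orthonormal(3), of X]
    dird_mink_const[OF q smooth_e(1) smooth_y y_normal(2), of X]
    dird_mink_const[OF q smooth_e(2) smooth_y y_normal(2), of X]
    mink_commute[of "e\<^sub>1 q" "dird X e\<^sub>1 q"] mink_commute[of "e\<^sub>2 q" "dird X e\<^sub>2 q"]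
    mink_commute[of "e\<^sub>1 q" "dird X e\<^sub>2 q"]
  by simp_all

text \<open>The Levi-Civita connection has no torsion. The image of the bracket is tangent, so its
  products with \<open>e\<^sub>1\<close> and \<open>e\<^sub>2\<close> determine it.\<close>

lemma lie_bracket:
  assumes q: "q \<in> W"
  shows "dird E\<^sub>1 E\<^sub>2 q - dird E\<^sub>2 E\<^sub>1 q = - a q *\<^sub>R E\<^sub>1 q - b q *\<^sub>R E\<^sub>2 q"
proof -
  let ?L = "dird E\<^sub>1 E\<^sub>2 q - dird E\<^sub>2 E\<^sub>1 q"
  have L: "frechet_derivative y (at q) ?L = dird E\<^sub>1 e\<^sub>2 q - dird E\<^sub>2 e\<^sub>1 q"
    using dird_commutator[OF open_W q smooth_y smooth_E] by simp
  have "first_form y q ?L (E\<^sub>1 q) = - a q" "first_form y q ?L (E\<^sub>2 q) = - b q"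
    unfolding first_form_def L
    using dird_e_tangent[OF q, of E\<^sub>1] dird_e_tangent[OF q, of E\<^sub>2]
    by (simp_all add: mink_bilinear a_def b_def dird_def[of E\<^sub>1 y q, symmetric] dird_def[of E\<^sub>2 y q, symmetric])
  then show ?thesis
    using orthonormal_expand[OF differentiable_W[OF smooth_y q] basis[OF q], of ?L] by simp
qed

text \<open>The common integrability condition: for \<open>F = y\<close> it gives the symmetry of
  the second fundamental form, for the frame vectors the Gauss and Codazzi equations, for
  \<open>H\<close> the Ricci equation.\<close>

lemma commutator:
  fixes F :: "real^2 \<Rightarrow> 'b::euclidean_space"
  assumes q: "q \<in> W" and F: "smooth_on W F"
  shows "dird E\<^sub>1 (dird E\<^sub>2 F) q - dird E\<^sub>2 (dird E\<^sub>1 F) q = - a q *\<^sub>R dird E\<^sub>1 F q - b q *\<^sub>R dird E\<^sub>2 F q"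
  unfolding dird_commutator[OF open_W q F smooth_E] lie_bracket[OF q]
  unfolding frechet_derivative_linear[OF differentiable_W[OF F q]]
  by (simp add: dird_def)

lemma frame_equations:
  assumes q: "q \<in> W"
  shows "dird E\<^sub>1 e\<^sub>1 q = a q *\<^sub>R e\<^sub>2 q + A\<^sub>1\<^sub>1 q" "dird E\<^sub>1 e\<^sub>2 q = - a q *\<^sub>R e\<^sub>1 q + A\<^sub>1\<^sub>2 q"
    "dird E\<^sub>2 e\<^sub>1 q = b q *\<^sub>R e\<^sub>2 q + A\<^sub>1\<^sub>2 q" "dird E\<^sub>2 e\<^sub>2 q = - b q *\<^sub>R e\<^sub>1 q + A\<^sub>2\<^sub>2 q"
  using commutator[OF q smooth_y] by (simp_all add: A\<^sub>1\<^sub>1_def A\<^sub>1\<^sub>2_def A\<^sub>2\<^sub>2_def algebra_simps)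

lemma A_normal:
  assumes q: "q \<in> W"
  shows "mink (A\<^sub>1\<^sub>1 q) (e\<^sub>1 q) = 0" "mink (A\<^sub>1\<^sub>1 q) (e\<^sub>2 q) = 0" "mink (A\<^sub>1\<^sub>1 q) (y q) = -1"
    "mink (A\<^sub>1\<^sub>2 q) (e\<^sub>1 q) = 0" "mink (A\<^sub>1\<^sub>2 q) (e\<^sub>2 q) = 0" "mink (A\<^sub>1\<^sub>2 q) (y q) = 0"
    "mink (A\<^sub>2\<^sub>2 q) (e\<^sub>1 q) = 0" "mink (A\<^sub>2\<^sub>2 q) (e\<^sub>2 q) = 0" "mink (A\<^sub>2\<^sub>2 q) (y q) = -1"
    "mink (H q) (e\<^sub>1 q) = 0" "mink (H q) (e\<^sub>2 q) = 0" "mink (H q) (y q) = -1"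
  unfolding H_def A\<^sub>1\<^sub>1_def A\<^sub>1\<^sub>2_def A\<^sub>2\<^sub>2_def
  by (simp_all add: mink_bilinear dird_e_tangent[OF q] e_orthonormal[OF q] y_normal[OF q] a_def b_def)

text \<open>The Gauss curvature of the induced metric in terms of the connection form.\<close>

definition \<kappa> :: "real^2 \<Rightarrow> real" where
  "\<kappa> q = dird E\<^sub>2 a q - dird E\<^sub>1 b q - a q * a q - b q * b q"

lemma dird_frame_equations:
  assumes q: "q \<in> W"
  shows "dird X (dird E\<^sub>1 e\<^sub>1) q = a q *\<^sub>R dird X e\<^sub>2 q + dird X a q *\<^sub>R e\<^sub>2 q + dird X A\<^sub>1\<^sub>1 q"
    "dird X (dird E\<^sub>1 e\<^sub>2) q = - (a q *\<^sub>R dird X e\<^sub>1 q + dird X a q *\<^sub>R e\<^sub>1 q) + dird X A\<^sub>1\<^sub>2 q"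
    "dird X (dird E\<^sub>2 e\<^sub>1) q = b q *\<^sub>R dird X e\<^sub>2 q + dird X b q *\<^sub>R e\<^sub>2 q + dird X A\<^sub>1\<^sub>2 q"
    "dird X (dird E\<^sub>2 e\<^sub>2) q = - (b q *\<^sub>R dird X e\<^sub>1 q + dird X b q *\<^sub>R e\<^sub>1 q) + dird X A\<^sub>2\<^sub>2 q"
proof -
  note d = differentiable_fields[OF q]
  note r = dird_scaleR[OF d(4) d(2)] dird_scaleR[OF d(4) d(3)] dird_scaleR[OF d(5) d(2)] dird_scaleR[OF d(5) d(3)]
  note ds = differentiable_scaleR[OF d(4) d(2)] differentiable_scaleR[OF d(4) d(3)]
    differentiable_scaleR[OF d(5) d(2)] differentiable_scaleR[OF d(5) d(3)]
  have "dird X (dird E\<^sub>1 e\<^sub>1) q = dird X (\<lambda>q. a q *\<^sub>R e\<^sub>2 q + A\<^sub>1\<^sub>1 q) q"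
    by (rule dird_W_cong[OF q]) (auto simp: frame_equations intro: smooth_e)
  then show "dird X (dird E\<^sub>1 e\<^sub>1) q = a q *\<^sub>R dird X e\<^sub>2 q + dird X a q *\<^sub>R e\<^sub>2 q + dird X A\<^sub>1\<^sub>1 q"
    using dird_add[OF ds(2) d(6)] r by simp
  have "dird X (dird E\<^sub>1 e\<^sub>2) q = dird X (\<lambda>q. A\<^sub>1\<^sub>2 q - a q *\<^sub>R e\<^sub>1 q) q"
    by (rule dird_W_cong[OF q]) (auto simp: frame_equations intro: smooth_e)
  then show "dird X (dird E\<^sub>1 e\<^sub>2) q = - (a q *\<^sub>R dird X e\<^sub>1 q + dird X a q *\<^sub>R e\<^sub>1 q) + dird X A\<^sub>1\<^sub>2 q"
    using dird_diff[OF d(7) ds(1)] r by simp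
  have "dird X (dird E\<^sub>2 e\<^sub>1) q = dird X (\<lambda>q. b q *\<^sub>R e\<^sub>2 q + A\<^sub>1\<^sub>2 q) q"
    by (rule dird_W_cong[OF q]) (auto simp: frame_equations intro: smooth_e)
  then show "dird X (dird E\<^sub>2 e\<^sub>1) q = b q *\<^sub>R dird X e\<^sub>2 q + dird X b q *\<^sub>R e\<^sub>2 q + dird X A\<^sub>1\<^sub>2 q"
    using dird_add[OF ds(4) d(7)] r by simp
  have "dird X (dird E\<^sub>2 e\<^sub>2) q = dird X (\<lambda>q. A\<^sub>2\<^sub>2 q - b q *\<^sub>R e\<^sub>1 q) q"
    by (rule dird_W_cong[OF q]) (auto simp: frame_equations intro: smooth_e)
  then show "dird X (dird E\<^sub>2 e\<^sub>2) q = - (b q *\<^sub>R dird X e\<^sub>1 q + dird X b q *\<^sub>R e\<^sub>1 q) + dird X A\<^sub>2\<^sub>2 q"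
    using dird_diff[OF d(8) ds(3)] r by simp
qed

text \<open>These are unprojected identities in the ambient space. Their normal parts are the
  Codazzi equations, and their tangent parts contain the Gauss equation, hence the terms with
  \<open>\<kappa>\<close>.\<close>

lemma codazzi:
  assumes q: "q \<in> W"
  shows "dird E\<^sub>1 A\<^sub>1\<^sub>2 q = dird E\<^sub>2 A\<^sub>1\<^sub>1 q + \<kappa> q *\<^sub>R e\<^sub>2 q - a q *\<^sub>R A\<^sub>1\<^sub>1 q - (2 * b q) *\<^sub>R A\<^sub>1\<^sub>2 q + a q *\<^sub>R A\<^sub>2\<^sub>2 q"
    "dird E\<^sub>2 A\<^sub>1\<^sub>2 q = dird E\<^sub>1 A\<^sub>2\<^sub>2 q + \<kappa> q *\<^sub>R e\<^sub>1 q - b q *\<^sub>R A\<^sub>1\<^sub>1 q + (2 * a q) *\<^sub>R A\<^sub>1\<^sub>2 q + b q *\<^sub>R A\<^sub>2\<^sub>2 q"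
  using commutator[OF q smooth_e(1)] commutator[OF q smooth_e(2)]
  unfolding dird_frame_equations[OF q] frame_equations[OF q] \<kappa>_def
  by (simp_all add: algebra_simps vec_eq_iff)

section \<open>Derivatives and Laplacian of the Gauss map\<close>

lemma dird_nu:
  assumes q: "q \<in> W"
  shows "dird E\<^sub>1 \<nu> q = wedge (A\<^sub>1\<^sub>1 q) (e\<^sub>2 q) + wedge (e\<^sub>1 q) (A\<^sub>1\<^sub>2 q)"
    "dird E\<^sub>2 \<nu> q = wedge (A\<^sub>1\<^sub>2 q) (e\<^sub>2 q) + wedge (e\<^sub>1 q) (A\<^sub>2\<^sub>2 q)"
  unfolding \<nu>_def[abs_def] dird_wedge[OF differentiable_fields(2,3)[OF q]] frame_equations[OF q]
  by (simp_all add: wedge_bilinear)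

lemma dird_dird_nu:
  assumes q: "q \<in> W"
  shows "dird X (dird E\<^sub>1 \<nu>) q = wedge (A\<^sub>1\<^sub>1 q) (dird X e\<^sub>2 q) + wedge (dird X A\<^sub>1\<^sub>1 q) (e\<^sub>2 q)
      + (wedge (e\<^sub>1 q) (dird X A\<^sub>1\<^sub>2 q) + wedge (dird X e\<^sub>1 q) (A\<^sub>1\<^sub>2 q))"
    "dird X (dird E\<^sub>2 \<nu>) q = wedge (A\<^sub>1\<^sub>2 q) (dird X e\<^sub>2 q) + wedge (dird X A\<^sub>1\<^sub>2 q) (e\<^sub>2 q)
      + (wedge (e\<^sub>1 q) (dird X A\<^sub>2\<^sub>2 q) + wedge (dird X e\<^sub>1 q) (A\<^sub>2\<^sub>2 q))"
proof -
  note d = differentiable_fields[OF q]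
  note w = differentiable_bounded_bilinear[OF bounded_bilinear_wedge]
  have "dird X (dird E\<^sub>1 \<nu>) q = dird X (\<lambda>q. wedge (A\<^sub>1\<^sub>1 q) (e\<^sub>2 q) + wedge (e\<^sub>1 q) (A\<^sub>1\<^sub>2 q)) q"
    by (rule dird_W_cong[OF q]) (auto simp: dird_nu intro: smooth_nu)
  then show "dird X (dird E\<^sub>1 \<nu>) q = wedge (A\<^sub>1\<^sub>1 q) (dird X e\<^sub>2 q) + wedge (dird X A\<^sub>1\<^sub>1 q) (e\<^sub>2 q)
      + (wedge (e\<^sub>1 q) (dird X A\<^sub>1\<^sub>2 q) + wedge (dird X e\<^sub>1 q) (A\<^sub>1\<^sub>2 q))"
    using dird_add[OF w[OF d(6,3)] w[OF d(2,7)]] dird_wedge[OF d(6,3)] dird_wedge[OF d(2,7)] by simp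
  have "dird X (dird E\<^sub>2 \<nu>) q = dird X (\<lambda>q. wedge (A\<^sub>1\<^sub>2 q) (e\<^sub>2 q) + wedge (e\<^sub>1 q) (A\<^sub>2\<^sub>2 q)) q"
    by (rule dird_W_cong[OF q]) (auto simp: dird_nu intro: smooth_nu)
  then show "dird X (dird E\<^sub>2 \<nu>) q = wedge (A\<^sub>1\<^sub>2 q) (dird X e\<^sub>2 q) + wedge (dird X A\<^sub>1\<^sub>2 q) (e\<^sub>2 q)
      + (wedge (e\<^sub>1 q) (dird X A\<^sub>2\<^sub>2 q) + wedge (dird X e\<^sub>1 q) (A\<^sub>2\<^sub>2 q))"
    using dird_add[OF w[OF d(7,3)] w[OF d(2,8)]] dird_wedge[OF d(7,3)] dird_wedge[OF d(2,8)] by simp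
qed

lemma levi_civita_frame:
  assumes q: "q \<in> W"
  shows "levi_civita y E\<^sub>1 E\<^sub>1 q = a q *\<^sub>R E\<^sub>2 q" "levi_civita y E\<^sub>2 E\<^sub>2 q = - b q *\<^sub>R E\<^sub>1 q"
proof -
  note dy = differentiable_W[OF smooth_y q]
  have e: "frechet_derivative y (at q) (E\<^sub>1 q) = e\<^sub>1 q" "frechet_derivative y (at q) (E\<^sub>2 q) = e\<^sub>2 q"
    by (simp_all add: dird_def)
  have "frechet_derivative y (at q) (levi_civita y E\<^sub>1 E\<^sub>1 q) = frechet_derivative y (at q) (a q *\<^sub>R E\<^sub>2 q)"
    "frechet_derivative y (at q) (levi_civita y E\<^sub>2 E\<^sub>2 q) = frechet_derivative y (at q) (- b q *\<^sub>R E\<^sub>1 q)"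
    unfolding frechet_derivative_levi_civita[OF open_W q smooth_y smooth_E(1) basis[OF q]]
      frechet_derivative_levi_civita[OF open_W q smooth_y smooth_E(2) basis[OF q]]
      tangent_part_orthonormal[OF dy basis[OF q]] frechet_derivative_linear[OF dy] e
    by (simp_all add: dird_e_tangent[OF q] a_def b_def)
  then show "levi_civita y E\<^sub>1 E\<^sub>1 q = a q *\<^sub>R E\<^sub>2 q" "levi_civita y E\<^sub>2 E\<^sub>2 q = - b q *\<^sub>R E\<^sub>1 q"
    using frechet_derivative_inj[OF dy basis[OF q]] by blast+
qed

lemma frame_laplacian_frame:
  fixes F :: "real^2 \<Rightarrow> 'b::real_normed_vector"
  assumes q: "q \<in> W" and F: "smooth_on W F"
  shows "frame_laplacian y E\<^sub>1 E\<^sub>2 F q = - dird E\<^sub>1 (dird E\<^sub>1 F) q - dird E\<^sub>2 (dird E\<^sub>2 F) q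
     + a q *\<^sub>R dird E\<^sub>2 F q - b q *\<^sub>R dird E\<^sub>1 F q"
proof -
  have "dird (levi_civita y E\<^sub>1 E\<^sub>1) F q = a q *\<^sub>R dird E\<^sub>2 F q"
    "dird (levi_civita y E\<^sub>2 E\<^sub>2) F q = - b q *\<^sub>R dird E\<^sub>1 F q"
    unfolding dird_def levi_civita_frame[OF q] frechet_derivative_linear[OF differentiable_W[OF F q]]
    by simp_all
  then show ?thesis by (simp add: frame_laplacian_def)
qed

text \<open>The normal derivative of the mean curvature vector of de Sitter space along
  \<open>E\<^sub>1\<close>: that vector differs from \<open>H\<close> by \<open>y\<close>, whose
  derivatives are tangent.\<close>

definition N\<^sub>1 :: "real^2 \<Rightarrow> real^5" where
  "N\<^sub>1 q = dird E\<^sub>1 H q - mink (dird E\<^sub>1 H q) (e\<^sub>1 q) *\<^sub>R e\<^sub>1 q - mink (dird E\<^sub>1 H q) (e\<^sub>2 q) *\<^sub>R e\<^sub>2 q"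

definition N\<^sub>2 :: "real^2 \<Rightarrow> real^5" where
  "N\<^sub>2 q = dird E\<^sub>2 H q - mink (dird E\<^sub>2 H q) (e\<^sub>1 q) *\<^sub>R e\<^sub>1 q - mink (dird E\<^sub>2 H q) (e\<^sub>2 q) *\<^sub>R e\<^sub>2 q"

text \<open>The curvature and the tangent parts of the derivatives of \<open>H\<close> combine in
  the coefficient of \<open>\<nu>\<close>. By the Gauss equation this is minus the squared length of
  the second fundamental form in Minkowski space.\<close>

definition \<mu> :: "real^2 \<Rightarrow> real" where
  "\<mu> q = 2 * \<kappa> q + 2 * mink (dird E\<^sub>1 H q) (e\<^sub>1 q) + 2 * mink (dird E\<^sub>2 H q) (e\<^sub>2 q)"

lemma dird_H:
  assumes q: "q \<in> W"
  shows "dird X A\<^sub>1\<^sub>1 q + dird X A\<^sub>2\<^sub>2 q = 2 *\<^sub>R dird X H q"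
proof -
  note d = differentiable_fields[OF q]
  have "dird X H q = (1/2) *\<^sub>R (dird X A\<^sub>1\<^sub>1 q + dird X A\<^sub>2\<^sub>2 q)"
    unfolding H_def[abs_def]
    unfolding dird_bounded_linear[OF bounded_linear_scaleR_right differentiable_add[OF d(6,8)]]
      dird_add[OF d(6,8)] ..
  then show ?thesis by simp
qed

text \<open>Second derivatives of \<open>\<nu>\<close> contain derivatives of single components
  \<open>A\<^sub>i\<^sub>j\<close>. The Codazzi equations trade the mixed ones for derivatives of
  \<open>A\<^sub>1\<^sub>1\<close> and \<open>A\<^sub>2\<^sub>2\<close>, and these complete one
  another to derivatives of the trace.\<close>

lemma laplacian_nu:
  assumes q: "q \<in> W"
  shows "frame_laplacian y E\<^sub>1 E\<^sub>2 \<nu> q = - (2 *\<^sub>R wedge (N\<^sub>1 q) (e\<^sub>2 q) + 2 *\<^sub>R wedge (e\<^sub>1 q) (N\<^sub>2 q)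
     + \<mu> q *\<^sub>R \<nu> q + 2 *\<^sub>R wedge (A\<^sub>1\<^sub>1 q - A\<^sub>2\<^sub>2 q) (A\<^sub>1\<^sub>2 q))"
proof -
  have A11: "dird E\<^sub>1 A\<^sub>1\<^sub>1 q = 2 *\<^sub>R dird E\<^sub>1 H q - dird E\<^sub>1 A\<^sub>2\<^sub>2 q"
    and A22: "dird E\<^sub>2 A\<^sub>2\<^sub>2 q = 2 *\<^sub>R dird E\<^sub>2 H q - dird E\<^sub>2 A\<^sub>1\<^sub>1 q"
    using dird_H[OF q, of E\<^sub>1] dird_H[OF q, of E\<^sub>2] by (simp_all add: eq_diff_eq add.commute)
  \<comment> \<open>Moving \<open>e\<^sub>1\<close> to the front and \<open>e\<^sub>2\<close> to the
    back brings equal bivectors into the same form.\<close>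
  have c: "wedge (e\<^sub>2 q) v = - wedge v (e\<^sub>2 q)" "wedge v (e\<^sub>1 q) = - wedge (e\<^sub>1 q) v"
    "wedge (A\<^sub>1\<^sub>2 q) (A\<^sub>2\<^sub>2 q) = - wedge (A\<^sub>2\<^sub>2 q) (A\<^sub>1\<^sub>2 q)" for v
    by (rule wedge_commute)+
  show ?thesis
    unfolding frame_laplacian_frame[OF q smooth_nu] dird_dird_nu[OF q] dird_nu[OF q] frame_equations[OF q]
      codazzi[OF q] A11 A22 N\<^sub>1_def N\<^sub>2_def \<mu>_def \<nu>_def
    unfolding wedge_bilinear wedge_self c
    by (simp add: algebra_simps vec_eq_iff)
qed

section \<open>The mean curvature vector and its normal derivative\<close>

lemma normal_part_frame:
  assumes q: "q \<in> W"
  shows "normal_part y q w = w - mink w (e\<^sub>1 q) *\<^sub>R e\<^sub>1 q - mink w (e\<^sub>2 q) *\<^sub>R e\<^sub>2 q"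
  unfolding normal_part_def tangent_part_orthonormal[OF differentiable_W[OF smooth_y q] basis[OF q]]
  by (simp add: dird_def)

text \<open>Differentiating the orthogonality of \<open>y\<close> and a frame vector shows that both
  diagonal second derivatives have position component -1. Removing it adds one \<open>y\<close>
  each, and the average is \<open>y\<close>.\<close>

lemma mean_curvature_frame:
  assumes q: "q \<in> W"
  shows "mean_curvature y q = H q + y q"
proof -
  note dy = differentiable_W[OF smooth_y q]
  have e: "mink (frechet_derivative y (at q) w) (y q) = 0" for w
    using y_normal(2)[OF q, of "\<lambda>_. w"] by (simp add: dird_def)
  have t: "normal_part y q (frechet_derivative y (at q) w) = 0" for w
    by (simp add: normal_part_def tangent_part_tangent[OF dy basis[OF q]])
  have hess: "hess y q (E\<^sub>1 q) (E\<^sub>1 q) = dird E\<^sub>1 e\<^sub>1 q - frechet_derivative y (at q) (dird E\<^sub>1 E\<^sub>1 q)"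
    "hess y q (E\<^sub>2 q) (E\<^sub>2 q) = dird E\<^sub>2 e\<^sub>2 q - frechet_derivative y (at q) (dird E\<^sub>2 E\<^sub>2 q)"
    using dird_dird[OF open_W q smooth_y smooth_E(1)] dird_dird[OF open_W q smooth_y smooth_E(2)] by simp_all
  have ny: "normal_part y q (y q) = y q" by (simp add: normal_part_frame[OF q] y_normal[OF q])
  have "normal_part y q (dird E\<^sub>1 e\<^sub>1 q) = A\<^sub>1\<^sub>1 q" "normal_part y q (dird E\<^sub>2 e\<^sub>2 q) = A\<^sub>2\<^sub>2 q"
    by (simp_all add: normal_part_frame[OF q] dird_e_tangent[OF q] A\<^sub>1\<^sub>1_def A\<^sub>2\<^sub>2_def a_def b_def)
  then have "mean_curvature y q = (1/2) *\<^sub>R (A\<^sub>1\<^sub>1 q + y q + (A\<^sub>2\<^sub>2 q + y q))"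
    unfolding mean_curvature_orthonormal[OF open_W q smooth_y basis[OF q]] hess
      normal_part_add normal_part_diff normal_part_scaleR t ny
    by (simp add: mink_bilinear e dird_e_tangent[OF q] e_orthonormal[OF q])
  then show ?thesis by (simp add: H_def vec_eq_iff field_simps)
qed

text \<open>Reduces parallelism in all directions to \<open>N\<^sub>1 = N\<^sub>2 = 0\<close>. The
  projection to de Sitter space changes nothing here, because the derivatives of \<open>H\<close>
  are orthogonal to \<open>y\<close>.\<close>

lemma normal_connection_mean_curvature:
  assumes q: "q \<in> W"
  shows "normal_connection y X (mean_curvature y) q =
    first_form y q (X q) (E\<^sub>1 q) *\<^sub>R N\<^sub>1 q + first_form y q (X q) (E\<^sub>2 q) *\<^sub>R N\<^sub>2 q"
proof -
  note d = differentiable_fields[OF q]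
  have "dird X (\<lambda>q. H q + y q) q = dird X (mean_curvature y) q"
    by (rule dird_W_cong[OF q]) (auto simp: mean_curvature_frame intro: smooth_on_add open_W smooth_H smooth_y)
  then have m: "dird X (mean_curvature y) q = dird X H q + dird X y q"
    using dird_add[OF d(9,1)] by simp
  have "mink (dird X H q) (y q) = 0"
    using dird_mink_const[OF q smooth_H smooth_y A_normal(12), of X]
      orthonormal_expand[OF d(1) basis[OF q], of "X q"] A_normal[OF q]
    by (metis (no_types, lifting) add.right_neutral add.inverse_neutral dird_def
        frechet_derivative_linear(1,3)[OF d(1)] mink.add_right mink.scaleR_right minus_equation_iff scaleR_zero_right)
  then have "normal_connection y X (mean_curvature y) q = normal_part y q (dird X H q) + normal_part y q (dird X y q)"
    by (simp add: normal_connection_def de_sitter_connection_def m mink_bilinear y_normal[OF q] normal_part_add)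
  also have "normal_part y q (dird X y q) = 0"
    by (simp add: normal_part_def dird_def tangent_part_tangent[OF d(1) basis[OF q]])
  also have "dird X H q = first_form y q (X q) (E\<^sub>1 q) *\<^sub>R dird E\<^sub>1 H q + first_form y q (X q) (E\<^sub>2 q) *\<^sub>R dird E\<^sub>2 H q"
    unfolding dird_def using orthonormal_expand[OF d(1) basis[OF q], of "X q"]
    by (metis frechet_derivative_linear(1,3)[OF d(9)])
  finally show ?thesis
    unfolding N\<^sub>1_def N\<^sub>2_def
    by (simp add: normal_part_add normal_part_scaleR normal_part_frame[OF q])
qed

section \<open>From the 1-type equation to parallel mean curvature\<close>

lemma N_normal:
  assumes q: "q \<in> W"
  shows "mink (N\<^sub>1 q) (e\<^sub>1 q) = 0" "mink (N\<^sub>1 q) (e\<^sub>2 q) = 0" "mink (N\<^sub>1 q) (y q) = 0"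
    "mink (N\<^sub>2 q) (e\<^sub>1 q) = 0" "mink (N\<^sub>2 q) (e\<^sub>2 q) = 0" "mink (N\<^sub>2 q) (y q) = 0"
proof -
  have "mink (dird E\<^sub>1 H q) (y q) = 0" "mink (dird E\<^sub>2 H q) (y q) = 0"
    using dird_mink_const[OF q smooth_H smooth_y A_normal(12), of E\<^sub>1]
      dird_mink_const[OF q smooth_H smooth_y A_normal(12), of E\<^sub>2] A_normal[OF q] by simp_all
  then show "mink (N\<^sub>1 q) (e\<^sub>1 q) = 0" "mink (N\<^sub>1 q) (e\<^sub>2 q) = 0" "mink (N\<^sub>1 q) (y q) = 0"
    "mink (N\<^sub>2 q) (e\<^sub>1 q) = 0" "mink (N\<^sub>2 q) (e\<^sub>2 q) = 0" "mink (N\<^sub>2 q) (y q) = 0"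
    by (simp_all add: N\<^sub>1_def N\<^sub>2_def mink_bilinear e_orthonormal[OF q] y_normal[OF q])
qed

text \<open>The position components of \<open>A\<^sub>1\<^sub>1\<close> and
  \<open>A\<^sub>2\<^sub>2\<close> cancel in the difference, so all vectors that occur are
  orthogonal to \<open>y\<close>. Contraction with one frame vector isolates the normal derivative
  of \<open>H\<close> along the other.\<close>

lemma contract_laplacian_nu:
  assumes q: "q \<in> W"
  shows "contract (frame_laplacian y E\<^sub>1 E\<^sub>2 \<nu> q) (y q) = 0"
    "contract (frame_laplacian y E\<^sub>1 E\<^sub>2 \<nu> q) (e\<^sub>1 q) = 2 *\<^sub>R N\<^sub>2 q + \<mu> q *\<^sub>R e\<^sub>2 q"
    "contract (frame_laplacian y E\<^sub>1 E\<^sub>2 \<nu> q) (e\<^sub>2 q) = - (2 *\<^sub>R N\<^sub>1 q + \<mu> q *\<^sub>R e\<^sub>1 q)"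
  unfolding laplacian_nu[OF q] \<nu>_def contract_bilinear contract_wedge mink_bilinear
  by (simp_all add: N_normal[OF q] A_normal[OF q] e_orthonormal[OF q] y_normal[OF q])

lemma contract_nu:
  assumes q: "q \<in> W"
  shows "contract (\<nu> q) (y q) = 0" "contract (\<nu> q) (e\<^sub>1 q) = - e\<^sub>2 q" "contract (\<nu> q) (e\<^sub>2 q) = e\<^sub>1 q"
  unfolding \<nu>_def contract_wedge by (simp_all add: e_orthonormal[OF q] y_normal[OF q])

text \<open>Neither \<open>\<nu>\<close> nor its Laplacian involves the position vector. Hence, where \<open>f\<close> does not vanish,
  contraction with \<open>y\<close> annihilates \<open>C\<close>, and by differentiation so does contraction with tangent vectors.\<close>

lemma normal_derivative_eq_0:
  assumes f: "continuous_on W f"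
    and lap: "\<And>q. q \<in> W \<Longrightarrow> frame_laplacian y E\<^sub>1 E\<^sub>2 \<nu> q = f q *\<^sub>R (\<nu> q + C)"
    and p: "p \<in> W"
  shows "N\<^sub>1 p = 0" "N\<^sub>2 p = 0"
proof -
  \<comment> \<open>Keeping the factor \<open>f p\<close> makes a zero of \<open>f\<close> trivial.
    Elsewhere continuity of \<open>f\<close> provides a neighbourhood without zeros, on which the
    relation for \<open>C\<close> can be differentiated.\<close>
  have tangent: "f p *\<^sub>R contract C (dird X y p) = 0" for X
  proof (cases "f p = 0")
    case False
    let ?W = "W \<inter> f -` (- {0})"
    have W: "open ?W" "p \<in> ?W"
      using continuous_open_preimage[OF f open_W, of "- {0}"] p False by auto
    have "contract C (y q) = 0" if "q \<in> ?W" for q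
    proof -
      have "f q *\<^sub>R contract C (y q) = 0"
        using contract_laplacian_nu(1)[of q] lap[of q] contract_nu(1)[of q] that
        by (simp add: contract_bilinear)
      then show ?thesis using that by simp
    qed
    moreover have L: "bounded_linear (contract C)" by (rule contract.bounded_linear_right)
    ultimately have "dird X (\<lambda>q. contract C (y q)) p = dird X (\<lambda>q. 0) p"
      by (intro dird_cong[OF W]) (auto intro: differentiable_W[OF smooth_on_bounded_linear[OF _ open_W smooth_y] p])
    then show ?thesis
      using dird_bounded_linear[OF L differentiable_W[OF smooth_y p], of X] by simp
  qed simp
  have 1: "2 *\<^sub>R N\<^sub>1 p + \<mu> p *\<^sub>R e\<^sub>1 p = - f p *\<^sub>R e\<^sub>1 p"
  proof -
    have "- (2 *\<^sub>R N\<^sub>1 p + \<mu> p *\<^sub>R e\<^sub>1 p) = f p *\<^sub>R e\<^sub>1 p"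
      using contract_laplacian_nu(3)[OF p] tangent[of E\<^sub>2] unfolding lap[OF p] contract_bilinear contract_nu[OF p]
      by (simp add: scaleR_add_right)
    then show ?thesis by (metis minus_minus scaleR_minus_left)
  qed
  have 2: "2 *\<^sub>R N\<^sub>2 p + \<mu> p *\<^sub>R e\<^sub>2 p = - f p *\<^sub>R e\<^sub>2 p"
    using contract_laplacian_nu(2)[OF p] tangent[of E\<^sub>1] unfolding lap[OF p] contract_bilinear contract_nu[OF p]
    by (auto simp: scaleR_diff_right)
  \<comment> \<open>\<open>N\<^sub>1\<close> is normal, so pairing with \<open>e\<^sub>1\<close>
    sees only the tangent terms; once these agree, the normal ones must vanish.\<close>
  have "\<mu> p = - f p"
    using arg_cong[OF 1, of "\<lambda>v. mink v (e\<^sub>1 p)"] N_normal[OF p] e_orthonormal[OF p] by (simp add: mink_bilinear)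
  then show "N\<^sub>1 p = 0" "N\<^sub>2 p = 0" using 1 2 by simp_all
qed

section \<open>Parallel mean curvature and the Ricci equation\<close>

lemma mink_dird_H:
  assumes q: "q \<in> W"
  shows "mink (dird E\<^sub>1 H q) (e\<^sub>1 q) = - mink (H q) (A\<^sub>1\<^sub>1 q)" "mink (dird E\<^sub>1 H q) (e\<^sub>2 q) = - mink (H q) (A\<^sub>1\<^sub>2 q)"
    "mink (dird E\<^sub>2 H q) (e\<^sub>1 q) = - mink (H q) (A\<^sub>1\<^sub>2 q)" "mink (dird E\<^sub>2 H q) (e\<^sub>2 q) = - mink (H q) (A\<^sub>2\<^sub>2 q)"
  using dird_mink_const[OF q smooth_H smooth_e(1) A_normal(10), of E\<^sub>1]
    dird_mink_const[OF q smooth_H smooth_e(2) A_normal(11), of E\<^sub>1]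
    dird_mink_const[OF q smooth_H smooth_e(1) A_normal(10), of E\<^sub>2]
    dird_mink_const[OF q smooth_H smooth_e(2) A_normal(11), of E\<^sub>2]
  by (simp_all add: frame_equations[OF q] mink_bilinear A_normal[OF q])

text \<open>A non-zero parallel normal field makes the normal connection flat; the Ricci equation then says that
  the shape operators commute.\<close>

lemma ricci_eq_0:
  assumes N: "\<And>q. q \<in> W \<Longrightarrow> N\<^sub>1 q = 0" "\<And>q. q \<in> W \<Longrightarrow> N\<^sub>2 q = 0"
    and q: "q \<in> W" and nz: "mean_curvature y q \<noteq> 0"
  shows "wedge (A\<^sub>1\<^sub>1 q - A\<^sub>2\<^sub>2 q) (A\<^sub>1\<^sub>2 q) = 0"
proof -
  define m where "m A q = mink (H q) (A q)" for A :: "real^2 \<Rightarrow> real^5" and q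
  have H1: "dird E\<^sub>1 H q = - (m A\<^sub>1\<^sub>1 q *\<^sub>R e\<^sub>1 q + m A\<^sub>1\<^sub>2 q *\<^sub>R e\<^sub>2 q)" if "q \<in> W" for q
    using N(1)[OF that] by (simp add: N\<^sub>1_def mink_dird_H[OF that] m_def algebra_simps add_eq_0_iff)
  have H2: "dird E\<^sub>2 H q = - (m A\<^sub>1\<^sub>2 q *\<^sub>R e\<^sub>1 q + m A\<^sub>2\<^sub>2 q *\<^sub>R e\<^sub>2 q)" if "q \<in> W" for q
    using N(2)[OF that] by (simp add: N\<^sub>2_def mink_dird_H[OF that] m_def algebra_simps add_eq_0_iff)
  have sm: "smooth_on W (m A)" if "smooth_on W A" for A
    unfolding m_def[abs_def] by (rule smooth_on_bounded_bilinear[OF bounded_bilinear_mink open_W smooth_H that])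
  note d = differentiable_fields[OF q]
  \<comment> \<open>Derivatives of the coefficients multiply tangent vectors, so the normal part
    loses them and only derivatives of the frame count.\<close>
  have dd: "normal_part y q (dird X (\<lambda>q. - (m A q *\<^sub>R e\<^sub>1 q + m B q *\<^sub>R e\<^sub>2 q)) q) =
      - (m A q *\<^sub>R normal_part y q (dird X e\<^sub>1 q) + m B q *\<^sub>R normal_part y q (dird X e\<^sub>2 q))"
    if "smooth_on W A" "smooth_on W B" for A B X
  proof -
    have n: "normal_part y q (e\<^sub>1 q) = 0" "normal_part y q (e\<^sub>2 q) = 0"
      by (simp_all add: normal_part_frame[OF q] e_orthonormal[OF q])
    have dm: "m A differentiable at q" "m B differentiable at q"
      using sm that differentiable_W q by blast+
    note ds = differentiable_scaleR[OF dm(1) d(2)] differentiable_scaleR[OF dm(2) d(3)]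
    show ?thesis
      unfolding dird_bounded_linear[OF bounded_linear_minus[OF bounded_linear_ident] differentiable_add[OF ds]]
        dird_add[OF ds] dird_scaleR[OF dm(1) d(2)] dird_scaleR[OF dm(2) d(3)]
      using normal_part_scaleR[of y q "-1"] by (simp add: normal_part_add normal_part_diff normal_part_scaleR n)
  qed
  have n: "normal_part y q (dird E\<^sub>1 e\<^sub>1 q) = A\<^sub>1\<^sub>1 q" "normal_part y q (dird E\<^sub>1 e\<^sub>2 q) = A\<^sub>1\<^sub>2 q"
    "normal_part y q (dird E\<^sub>2 e\<^sub>1 q) = A\<^sub>1\<^sub>2 q" "normal_part y q (dird E\<^sub>2 e\<^sub>2 q) = A\<^sub>2\<^sub>2 q"
    unfolding frame_equations[OF q]
    by (simp_all add: normal_part_frame[OF q] mink_bilinear A_normal[OF q] e_orthonormal[OF q])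
  have "dird E\<^sub>1 (dird E\<^sub>2 H) q = dird E\<^sub>1 (\<lambda>q. - (m A\<^sub>1\<^sub>2 q *\<^sub>R e\<^sub>1 q + m A\<^sub>2\<^sub>2 q *\<^sub>R e\<^sub>2 q)) q"
    by (rule dird_W_cong[OF q H2]) (auto intro: smooth_H)
  then have 12: "normal_part y q (dird E\<^sub>1 (dird E\<^sub>2 H) q) = - (m A\<^sub>1\<^sub>2 q *\<^sub>R A\<^sub>1\<^sub>1 q + m A\<^sub>2\<^sub>2 q *\<^sub>R A\<^sub>1\<^sub>2 q)"
    using dd[OF smooth_A(2,3)] n by simp
  have "dird E\<^sub>2 (dird E\<^sub>1 H) q = dird E\<^sub>2 (\<lambda>q. - (m A\<^sub>1\<^sub>1 q *\<^sub>R e\<^sub>1 q + m A\<^sub>1\<^sub>2 q *\<^sub>R e\<^sub>2 q)) q"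
    by (rule dird_W_cong[OF q H1]) (auto intro: smooth_H)
  then have 21: "normal_part y q (dird E\<^sub>2 (dird E\<^sub>1 H) q) = - (m A\<^sub>1\<^sub>1 q *\<^sub>R A\<^sub>1\<^sub>2 q + m A\<^sub>1\<^sub>2 q *\<^sub>R A\<^sub>2\<^sub>2 q)"
    using dd[OF smooth_A(1,2)] n by simp
  have "normal_part y q (dird E\<^sub>1 H q) = 0" "normal_part y q (dird E\<^sub>2 H q) = 0"
    using N[OF q] by (simp_all add: normal_part_frame[OF q] N\<^sub>1_def N\<^sub>2_def)
  then have "normal_part y q (dird E\<^sub>1 (dird E\<^sub>2 H) q) = normal_part y q (dird E\<^sub>2 (dird E\<^sub>1 H) q)"
    using arg_cong[OF commutator[OF q smooth_H], of "normal_part y q"]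
    by (simp add: normal_part_diff normal_part_scaleR[of y q "- a q", simplified] normal_part_scaleR)
  then have ricci: "m A\<^sub>1\<^sub>2 q *\<^sub>R (A\<^sub>1\<^sub>1 q - A\<^sub>2\<^sub>2 q) = (m A\<^sub>1\<^sub>1 q - m A\<^sub>2\<^sub>2 q) *\<^sub>R A\<^sub>1\<^sub>2 q"
    unfolding 12 21 by (simp add: algebra_simps)
  show ?thesis
  \<comment> \<open>\<open>ricci\<close> says that contraction with \<open>H\<close> vanishes. The
    vector used is \<open>H + y\<close>, the mean curvature vector in de Sitter space: it is
    orthogonal to \<open>y\<close>, whereas \<open>H\<close> has position component -1.\<close>
  proof (rule bivector_eq_0[OF wedge_in_bivectors, where a = "y q" and b = "e\<^sub>1 q" and c = "e\<^sub>2 q" and d = "H q + y q"])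
    show "contract (wedge (A\<^sub>1\<^sub>1 q - A\<^sub>2\<^sub>2 q) (A\<^sub>1\<^sub>2 q)) (H q + y q) = 0"
      using ricci by (simp add: contract_wedge mink_bilinear A_normal[OF q] m_def mink_commute[of "H q"])
    show "H q + y q \<noteq> 0" using nz mean_curvature_frame[OF q] by simp
  qed (simp_all add: contract_wedge mink_bilinear A_normal[OF q] e_orthonormal[OF q] y_normal[OF q] sphere[OF q])
qed

text \<open>The factor is determined by \<open>\<langle>\<nu>, \<nu>\<rangle> = 1\<close>, which expresses \<open>\<langle>\<Delta>\<nu>, \<nu>\<rangle>\<close> by first derivatives of \<open>\<nu>\<close>.\<close>

lemma laplacian_nu_parallel:
  assumes N: "\<And>q. q \<in> W \<Longrightarrow> N\<^sub>1 q = 0" "\<And>q. q \<in> W \<Longrightarrow> N\<^sub>2 q = 0"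
    and q: "q \<in> W" and nz: "mean_curvature y q \<noteq> 0"
  shows "frame_laplacian y E\<^sub>1 E\<^sub>2 \<nu> q =
    (biv_inner (dird E\<^sub>1 \<nu> q) (dird E\<^sub>1 \<nu> q) + biv_inner (dird E\<^sub>2 \<nu> q) (dird E\<^sub>2 \<nu> q)) *\<^sub>R \<nu> q"
proof -
  have lap: "frame_laplacian y E\<^sub>1 E\<^sub>2 \<nu> q = - \<mu> q *\<^sub>R \<nu> q"
    using ricci_eq_0[OF N q nz] N[OF q]
    by (simp add: laplacian_nu[OF q] wedge.zero_left wedge.zero_right)
  have unit: "biv_inner (\<nu> p) (\<nu> p) = 1" if "p \<in> W" for p
    unfolding \<nu>_def biv_inner_wedge by (simp add: e_orthonormal[OF that])
  have const: "biv_inner (F q) (dird X G q) = - biv_inner (dird X F q) (G q)"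
    if F: "smooth_on W F" "smooth_on W G" and c: "\<And>q. q \<in> W \<Longrightarrow> biv_inner (F q) (G q) = c"
      and q: "q \<in> W" for F G X q and c :: real
  proof -
    have "dird X (\<lambda>q. biv_inner (F q) (G q)) q = dird X (\<lambda>q. c) q"
      by (rule dird_W_cong[OF q c smooth_on_bounded_bilinear[OF bounded_bilinear_biv_inner open_W F]])
    then show ?thesis using dird_biv_inner[OF F[THEN differentiable_W, OF q], of X] by simp
  qed
  \<comment> \<open>Differentiated once more, this trades second derivatives of \<open>\<nu>\<close>
    for squares of first ones; as it stands, it removes the first-order terms of the
    Laplacian.\<close>
  have orth: "biv_inner (\<nu> p) (dird X \<nu> p) = 0" if "p \<in> W" for X p
    using const[OF smooth_nu smooth_nu unit that, of X] biv_inner_commute[of "\<nu> p"] by simp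
  have "biv_inner (\<nu> q) (dird E\<^sub>1 (dird E\<^sub>1 \<nu>) q) = - biv_inner (dird E\<^sub>1 \<nu> q) (dird E\<^sub>1 \<nu> q)"
    "biv_inner (\<nu> q) (dird E\<^sub>2 (dird E\<^sub>2 \<nu>) q) = - biv_inner (dird E\<^sub>2 \<nu> q) (dird E\<^sub>2 \<nu> q)"
    using const[OF smooth_nu smooth_dird(1)[OF smooth_nu] orth q, of E\<^sub>1]
      const[OF smooth_nu smooth_dird(2)[OF smooth_nu] orth q, of E\<^sub>2] by simp_all
  then have "biv_inner (\<nu> q) (frame_laplacian y E\<^sub>1 E\<^sub>2 \<nu> q) =
      biv_inner (dird E\<^sub>1 \<nu> q) (dird E\<^sub>1 \<nu> q) + biv_inner (dird E\<^sub>2 \<nu> q) (dird E\<^sub>2 \<nu> q)"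
    unfolding frame_laplacian_frame[OF q smooth_nu]
    by (simp add: biv_inner.add_right biv_inner.diff_right biv_inner.minus_right biv_inner.scaleR_right orth[OF q])
  moreover have "biv_inner (\<nu> q) (frame_laplacian y E\<^sub>1 E\<^sub>2 \<nu> q) = - \<mu> q"
    unfolding lap by (simp add: biv_inner.minus_right biv_inner.scaleR_right unit[OF q])
  ultimately show ?thesis using lap by simp
qed

end

section \<open>The Gauss map in a chart\<close>

text \<open>The change of basis is an element of O(2) with determinant \<open>D\<close>; its first
  row fixes the second up to the sign \<open>D\<close>.\<close>

lemma orthonormal_basis_rotation:
  assumes dy: "y differentiable at p" and ob: "orthonormal_basis y p u v" and ob': "orthonormal_basis y p u' v'"
  obtains \<alpha> \<beta> D where "D * D = 1" "\<alpha> * \<alpha> + \<beta> * \<beta> = 1"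
    "u' = \<alpha> *\<^sub>R u + \<beta> *\<^sub>R v" "v' = (- D * \<beta>) *\<^sub>R u + (D * \<alpha>) *\<^sub>R v"
proof -
  define \<alpha> \<beta> \<gamma> \<delta> where "\<alpha> = first_form y p u' u" and "\<beta> = first_form y p u' v"
    and "\<gamma> = first_form y p v' u" and "\<delta> = first_form y p v' v"
  have u': "u' = \<alpha> *\<^sub>R u + \<beta> *\<^sub>R v" and v': "v' = \<gamma> *\<^sub>R u + \<delta> *\<^sub>R v"
    unfolding \<alpha>_def \<beta>_def \<gamma>_def \<delta>_def by (rule orthonormal_expand[OF dy ob])+
  have o: "first_form y p u u = 1" "first_form y p v v = 1" "first_form y p u v = 0" "first_form y p v u = 0"
    using ob by (auto simp: orthonormal_basis_def first_form_commute[of y p v u])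
  have r: "\<alpha> * \<alpha> + \<beta> * \<beta> = 1" "\<gamma> * \<gamma> + \<delta> * \<delta> = 1" "\<alpha> * \<gamma> + \<beta> * \<delta> = 0"
    using ob' unfolding orthonormal_basis_def u' v' first_form_bilinear[OF dy] by (simp_all add: o mult.commute)
  define D where "D = \<alpha> * \<delta> - \<beta> * \<gamma>"
  have g: "\<gamma> = - D * \<beta>" and d: "\<delta> = D * \<alpha>"
    unfolding D_def using r(1,3) by algebra+
  have "D * D = 1" using r unfolding g d by algebra
  then show thesis using that r(1) u' v' unfolding g d by blast
qed

lemma det_linear_combination:
  fixes u v :: "real^2"
  shows "det (vector [a *\<^sub>R u + b *\<^sub>R v, c *\<^sub>R u + d *\<^sub>R v] :: real^2^2) = (a * d - b * c) * det (vector [u, v] :: real^2^2)"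
  by (simp add: det_2 algebra_simps)

lemma det_vector_matrix:
  fixes L :: "real^2 \<Rightarrow> real^2"
  assumes "linear L"
  shows "det (vector [L u, L v] :: real^2^2) = det (matrix L) * det (vector [u, v] :: real^2^2)"
proof -
  have "L w = matrix L *v w" for w using assms by (simp add: matrix_works)
  then show ?thesis
    by (simp add: det_2 matrix_vector_mult_def sum_2 algebra_simps)
qed

text \<open>A change of orthonormal basis multiplies the wedge product by its determinant, and equal
  orientation forces this to be 1.\<close>

lemma gauss_map_eq:
  assumes dy: "y differentiable at p" and ob: "orthonormal_basis y p u v"
    and pos: "det (vector [u, v] :: real^2^2) > 0"
  shows "gauss_map y p = wedge (frechet_derivative y (at p) u) (frechet_derivative y (at p) v)"
  unfolding gauss_map_def
proof (rule the_equality)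
  fix w assume "\<exists>u v. orthonormal_basis y p u v \<and> 0 < det (vector [u, v] :: real^2^2) \<and>
      w = wedge (frechet_derivative y (at p) u) (frechet_derivative y (at p) v)"
  then obtain u' v' where ob': "orthonormal_basis y p u' v'" and pos': "0 < det (vector [u', v'] :: real^2^2)"
    and w: "w = wedge (frechet_derivative y (at p) u') (frechet_derivative y (at p) v')" by blast
  obtain \<alpha> \<beta> D where D: "D * D = 1" "\<alpha> * \<alpha> + \<beta> * \<beta> = 1"
    and u': "u' = \<alpha> *\<^sub>R u + \<beta> *\<^sub>R v" and v': "v' = (- D * \<beta>) *\<^sub>R u + (D * \<alpha>) *\<^sub>R v"
    using orthonormal_basis_rotation[OF dy ob ob'] .
  have det: "\<alpha> * (D * \<alpha>) - \<beta> * (- D * \<beta>) = D" using D(2) by algebra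
  have "D > 0" using pos' pos unfolding u' v' det_linear_combination det by (simp add: zero_less_mult_iff)
  moreover have "D = 1 \<or> D = -1" using D(1) by (simp add: square_eq_1_iff)
  ultimately have "D = 1" by auto
  have "w = (\<alpha> * (D * \<alpha>) - \<beta> * (- D * \<beta>)) *\<^sub>R wedge (frechet_derivative y (at p) u) (frechet_derivative y (at p) v)"
    unfolding w u' v' frechet_derivative_linear[OF dy] wedge_bilinear
    by (simp add: wedge_commute[of "frechet_derivative y (at p) v" "frechet_derivative y (at p) u"] algebra_simps)
  then show "w = wedge (frechet_derivative y (at p) u) (frechet_derivative y (at p) v)"
    unfolding det using \<open>D = 1\<close> by simp
qed (use ob pos in blast)

text \<open>Unlike the Laplacian, this involves only first derivatives of the Gauss map, which makes its
  independence of the chart immediate.\<close>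

definition gauss_energy :: "(real^2 \<Rightarrow> real^5) \<Rightarrow> real^2 \<Rightarrow> real" where
  "gauss_energy y p = (THE s. \<exists>u v. orthonormal_basis y p u v \<and>
     s = biv_inner (frechet_derivative (gauss_map y) (at p) u) (frechet_derivative (gauss_map y) (at p) u)
       + biv_inner (frechet_derivative (gauss_map y) (at p) v) (frechet_derivative (gauss_map y) (at p) v))"

text \<open>The trace of a quadratic form is invariant under all of O(2); the cross terms cancel
  because \<open>D * D = 1\<close>, so orientation does not matter here.\<close>

lemma gauss_energy_eq:
  assumes dy: "y differentiable at p" and dg: "gauss_map y differentiable at p"
    and ob: "orthonormal_basis y p u v"
  shows "gauss_energy y p =
    biv_inner (frechet_derivative (gauss_map y) (at p) u) (frechet_derivative (gauss_map y) (at p) u)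
    + biv_inner (frechet_derivative (gauss_map y) (at p) v) (frechet_derivative (gauss_map y) (at p) v)"
  unfolding gauss_energy_def
proof (rule the_equality)
  let ?d = "frechet_derivative (gauss_map y) (at p)"
  fix s assume "\<exists>u v. orthonormal_basis y p u v \<and> s = biv_inner (?d u) (?d u) + biv_inner (?d v) (?d v)"
  then obtain u' v' where ob': "orthonormal_basis y p u' v'"
    and s: "s = biv_inner (?d u') (?d u') + biv_inner (?d v') (?d v')" by blast
  obtain \<alpha> \<beta> D where D: "D * D = 1" "\<alpha> * \<alpha> + \<beta> * \<beta> = 1"
    and u': "u' = \<alpha> *\<^sub>R u + \<beta> *\<^sub>R v" and v': "v' = (- D * \<beta>) *\<^sub>R u + (D * \<alpha>) *\<^sub>R v"
    using orthonormal_basis_rotation[OF dy ob ob'] .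
  have "s = (\<alpha> * \<alpha> + (D * D) * (\<beta> * \<beta>)) * biv_inner (?d u) (?d u)
      + (\<beta> * \<beta> + (D * D) * (\<alpha> * \<alpha>)) * biv_inner (?d v) (?d v)
      + 2 * (\<alpha> * \<beta> - (D * D) * (\<alpha> * \<beta>)) * biv_inner (?d u) (?d v)"
    unfolding s u' v' frechet_derivative_linear[OF dg] biv_inner.add_left biv_inner.add_right
      biv_inner.scaleR_left biv_inner.scaleR_right biv_inner_commute[of "?d v" "?d u"] real_scaleR_def
    by algebra
  also have "\<dots> = (\<alpha> * \<alpha> + \<beta> * \<beta>) * biv_inner (?d u) (?d u) + (\<alpha> * \<alpha> + \<beta> * \<beta>) * biv_inner (?d v) (?d v)"
    unfolding D(1) by (simp add: add.commute)
  finally show "s = biv_inner (?d u) (?d u) + biv_inner (?d v) (?d v)" unfolding D(2) by simp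
qed (use ob in blast)

section \<open>Patches, oriented frames and the two implications in a chart\<close>

locale spacelike_patch =
  fixes y :: "real^2 \<Rightarrow> real^5" and V :: "(real^2) set"
  assumes open_V: "open V" and smooth_y: "smooth_on V y"
    and sphere: "p \<in> V \<Longrightarrow> mink (y p) (y p) = 1"
    and spacelike: "p \<in> V \<Longrightarrow> u \<noteq> 0 \<Longrightarrow> first_form y p u u > 0"
begin

lemma differentiable_y: "p \<in> V \<Longrightarrow> y differentiable at p"
  using smooth_on_differentiable[OF smooth_y open_V] .

text \<open>Gram-Schmidt applied to the coordinate fields.\<close>

lemma oriented_frame:
  obtains E\<^sub>1 E\<^sub>2 where "orthonormal_frame y V E\<^sub>1 E\<^sub>2"
    "\<And>p. p \<in> V \<Longrightarrow> det (vector [E\<^sub>1 p, E\<^sub>2 p] :: real^2^2) > 0"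
proof -
  define g where "g i j p = first_form y p (axis i 1) (axis j 1)" for i j :: 2 and p
  define d where "d p = g 1 1 p * g 2 2 p - g 1 2 p * g 1 2 p" for p
  \<comment> \<open>The second coordinate field minus its projection to the first, multiplied by
    \<open>g 1 1\<close> to avoid a division; its squared length is \<open>g 1 1\<close> times the
    Gram determinant \<open>d\<close>.\<close>
  define w where "w p = g 1 1 p *\<^sub>R axis 2 1 - g 1 2 p *\<^sub>R (axis 1 1 :: real^2)" for p
  have gc: "g 2 1 p = g 1 2 p" for p by (simp add: g_def first_form_commute)
  have g1: "g 1 1 p > 0" if "p \<in> V" for p
    unfolding g_def by (rule spacelike[OF that]) (simp add: axis_eq_0_iff)
  have w: "first_form y p (w p) (w p) = g 1 1 p * d p" "first_form y p (axis 1 1) (w p) = 0" if "p \<in> V" for p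
  proof -
    have w': "w p = g 1 1 p *\<^sub>R axis 2 1 + (- g 1 2 p) *\<^sub>R axis 1 1" by (simp add: w_def)
    show "first_form y p (w p) (w p) = g 1 1 p * d p" "first_form y p (axis 1 1) (w p) = 0"
      unfolding w' first_form_bilinear[OF differentiable_y[OF that]]
      by (simp_all add: g_def[symmetric] gc d_def algebra_simps)
  qed
  \<comment> \<open>Positivity is read off from \<open>w \<noteq> 0\<close>, which takes the place
    of the Cauchy-Schwarz inequality.\<close>
  have gd: "g 1 1 p * d p > 0" if "p \<in> V" for p
  proof -
    have "w p $ 2 \<noteq> 0" using g1[OF that] by (simp add: w_def axis_def)
    then have "w p \<noteq> 0" by auto
    then show ?thesis using spacelike[OF that] w(1)[OF that] by metis
  qed
  have sg: "smooth_on V (g i j)" for i j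
    unfolding g_def[abs_def] first_form_def
    by (intro smooth_on_bounded_bilinear[OF bounded_bilinear_mink open_V] smooth_on_frechet_derivative smooth_y)
  have sd: "smooth_on V (\<lambda>p. g 1 1 p * d p)"
    unfolding d_def by (intro smooth_on_mult[OF open_V] smooth_on_diff[OF open_V] sg)
  have sq: "r powr (-1/2) * (r powr (-1/2) * r) = 1" if "r > 0" for r :: real
  proof -
    have "r powr (-1/2) * r powr (-1/2) = r powr (-1)" by (simp flip: powr_add)
    then show ?thesis using that by (simp add: powr_minus_divide flip: mult.assoc)
  qed
  show thesis
  proof (rule that)
    show "orthonormal_frame y V (\<lambda>p. g 1 1 p powr (-1/2) *\<^sub>R axis 1 1) (\<lambda>p. (g 1 1 p * d p) powr (-1/2) *\<^sub>R w p)"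
      unfolding orthonormal_frame_def
    proof (intro conjI ballI)
      show "smooth_on V (\<lambda>p. g 1 1 p powr (-1/2) *\<^sub>R (axis 1 1 :: real^2))"
        by (intro smooth_on_scaleR[OF open_V] smooth_on_powr[OF open_V] smooth_on_const sg g1)
      show "smooth_on V (\<lambda>p. (g 1 1 p * d p) powr (-1/2) *\<^sub>R w p)"
        unfolding w_def
        by (intro smooth_on_scaleR[OF open_V] smooth_on_powr[OF open_V] smooth_on_const smooth_on_diff[OF open_V] sg sd gd)
      fix p assume p: "p \<in> V"
      show "orthonormal_basis y p (g 1 1 p powr (-1/2) *\<^sub>R axis 1 1) ((g 1 1 p * d p) powr (-1/2) *\<^sub>R w p)"
        unfolding orthonormal_basis_def first_form_bilinear[OF differentiable_y[OF p]] w[OF p]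
        using sq[OF g1[OF p]] sq[OF gd[OF p]] by (simp add: g_def)
    qed
    show "det (vector [g 1 1 p powr (-1/2) *\<^sub>R axis 1 1, (g 1 1 p * d p) powr (-1/2) *\<^sub>R w p] :: real^2^2) > 0"
      if "p \<in> V" for p
      using g1[OF that] gd[OF that] by (auto simp: det_2 w_def axis_def intro!: mult_pos_pos)
  qed
qed

lemma surface_frameI: "open W \<Longrightarrow> W \<subseteq> V \<Longrightarrow> orthonormal_frame y W E\<^sub>1 E\<^sub>2 \<Longrightarrow> surface_frame y W E\<^sub>1 E\<^sub>2"
  using smooth_on_subset[OF smooth_y] sphere by unfold_locales auto

lemma gauss_map_frame:
  assumes "p \<in> V" "orthonormal_basis y p (E\<^sub>1 p) (E\<^sub>2 p)" "det (vector [E\<^sub>1 p, E\<^sub>2 p] :: real^2^2) > 0"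
  shows "gauss_map y p = wedge (dird E\<^sub>1 y p) (dird E\<^sub>2 y p)"
  using gauss_map_eq[OF differentiable_y[OF assms(1)] assms(2,3)] by (simp add: dird_def)

lemma smooth_gauss_map: "smooth_on V (gauss_map y)"
proof -
  obtain E\<^sub>1 E\<^sub>2 where E: "orthonormal_frame y V E\<^sub>1 E\<^sub>2"
    "\<And>p. p \<in> V \<Longrightarrow> det (vector [E\<^sub>1 p, E\<^sub>2 p] :: real^2^2) > 0"
    using oriented_frame by blast
  interpret surface_frame y V E\<^sub>1 E\<^sub>2 by (rule surface_frameI[OF open_V _ E(1)]) simp
  show ?thesis
    by (rule smooth_on_cong[OF open_V _ smooth_nu]) (simp add: \<nu>_def gauss_map_frame[of _ E\<^sub>1 E\<^sub>2] basis E(2))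
qed

lemma differentiable_gauss_map: "p \<in> V \<Longrightarrow> gauss_map y differentiable at p"
  using smooth_on_differentiable[OF smooth_gauss_map open_V] .

lemma smooth_gauss_energy: "smooth_on V (gauss_energy y)"
proof -
  obtain E\<^sub>1 E\<^sub>2 where E: "orthonormal_frame y V E\<^sub>1 E\<^sub>2"
    using oriented_frame by blast
  interpret surface_frame y V E\<^sub>1 E\<^sub>2 by (rule surface_frameI[OF open_V _ E]) simp
  have "smooth_on V (\<lambda>p. biv_inner (dird E\<^sub>1 (gauss_map y) p) (dird E\<^sub>1 (gauss_map y) p)
      + biv_inner (dird E\<^sub>2 (gauss_map y) p) (dird E\<^sub>2 (gauss_map y) p))"
    by (intro smooth_on_add[OF open_V] smooth_on_bounded_bilinear[OF bounded_bilinear_biv_inner open_V]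
        smooth_dird smooth_gauss_map)
  then show ?thesis
    by (rule smooth_on_cong[OF open_V, rotated])
      (simp add: gauss_energy_eq[OF differentiable_y differentiable_gauss_map basis] dird_def)
qed

lemma parallel_if_laplacian:
  assumes lap: "has_laplacian y V (gauss_map y) (\<lambda>p. f p *\<^sub>R (gauss_map y p + C))"
    and f: "continuous_on V f" and p: "p \<in> V"
  shows "normal_connection y X (mean_curvature y) p = 0"
proof -
  obtain E\<^sub>1 E\<^sub>2 where E: "orthonormal_frame y V E\<^sub>1 E\<^sub>2"
    "\<And>p. p \<in> V \<Longrightarrow> det (vector [E\<^sub>1 p, E\<^sub>2 p] :: real^2^2) > 0"
    using oriented_frame by blast
  interpret surface_frame y V E\<^sub>1 E\<^sub>2 by (rule surface_frameI[OF open_V _ E(1)]) simp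
  have nu: "gauss_map y q = \<nu> q" if "q \<in> V" for q
    using that by (simp add: \<nu>_def gauss_map_frame[of _ E\<^sub>1 E\<^sub>2] basis E(2))
  have "frame_laplacian y E\<^sub>1 E\<^sub>2 \<nu> q = f q *\<^sub>R (\<nu> q + C)" if q: "q \<in> V" for q
  proof -
    have "frame_laplacian y E\<^sub>1 E\<^sub>2 \<nu> q = frame_laplacian y E\<^sub>1 E\<^sub>2 (gauss_map y) q"
      unfolding frame_laplacian_frame[OF q smooth_nu] frame_laplacian_frame[OF q smooth_gauss_map]
      using dird_W_cong[OF q nu[symmetric] smooth_nu]
        dird_W_cong[OF q dird_W_cong[OF _ nu[symmetric] smooth_nu] smooth_dird(1)[OF smooth_nu]]
        dird_W_cong[OF q dird_W_cong[OF _ nu[symmetric] smooth_nu] smooth_dird(2)[OF smooth_nu]]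
      by simp
    also have "\<dots> = f q *\<^sub>R (gauss_map y q + C)"
      using lap open_V E(1) q unfolding has_laplacian_def by blast
    finally show ?thesis by (simp add: nu[OF q])
  qed
  from normal_derivative_eq_0[OF f this p] show ?thesis
    by (simp add: normal_connection_mean_curvature[OF p])
qed

text \<open>The claim covers frames of either orientation, even ones whose orientation varies
  between components of \<open>W\<close>, while \<open>\<nu>\<close> agrees with the Gauss map only
  for positive frames. Restricting to a region of constant sign and, if necessary, exchanging the
  two fields, which preserves the Laplacian, settles all cases.\<close>

lemma laplacian_if_parallel:
  assumes par: "\<And>X p. p \<in> V \<Longrightarrow> smooth_on V X \<Longrightarrow> normal_connection y X (mean_curvature y) p = 0"
    and nz: "\<And>p. p \<in> V \<Longrightarrow> mean_curvature y p \<noteq> 0"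
  shows "has_laplacian y V (gauss_map y) (\<lambda>p. gauss_energy y p *\<^sub>R gauss_map y p)"
proof -
  have oriented: "frame_laplacian y E\<^sub>1 E\<^sub>2 (gauss_map y) p = gauss_energy y p *\<^sub>R gauss_map y p"
    if W: "open W" "W \<subseteq> V" and E: "orthonormal_frame y W E\<^sub>1 E\<^sub>2" and p: "p \<in> W"
      and pos: "\<And>q. q \<in> W \<Longrightarrow> det (vector [E\<^sub>1 q, E\<^sub>2 q] :: real^2^2) > 0" for W E\<^sub>1 E\<^sub>2 p
  proof -
    interpret surface_frame y W E\<^sub>1 E\<^sub>2 by (rule surface_frameI[OF W E])
    have smg: "smooth_on W (gauss_map y)" using smooth_gauss_map W smooth_on_subset by blast
    have nu: "gauss_map y q = \<nu> q" if "q \<in> W" for q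
      using that W by (auto simp: \<nu>_def gauss_map_frame[of _ E\<^sub>1 E\<^sub>2] basis pos)
    have N: "N\<^sub>1 q = 0" "N\<^sub>2 q = 0" if q: "q \<in> W" for q
    proof -
      have "first_form y q (E\<^sub>1 q) (E\<^sub>1 q) = 1" "first_form y q (E\<^sub>2 q) (E\<^sub>2 q) = 1"
        "first_form y q (E\<^sub>1 q) (E\<^sub>2 q) = 0" "first_form y q (E\<^sub>2 q) (E\<^sub>1 q) = 0"
        using basis[OF q] by (simp_all add: orthonormal_basis_def first_form_commute[of y q "E\<^sub>2 q" "E\<^sub>1 q"])
      \<comment> \<open>The frame is smooth on \<open>W\<close> only, whereas \<open>par\<close>
        asks for fields smooth on \<open>V\<close>. Constant fields with the values at
        \<open>q\<close> serve instead, since only the value at \<open>q\<close> enters.\<close>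
      then show "N\<^sub>1 q = 0" "N\<^sub>2 q = 0"
        using par[of q "\<lambda>_. E\<^sub>1 q", OF _ smooth_on_const] par[of q "\<lambda>_. E\<^sub>2 q", OF _ smooth_on_const] q W(2)
        by (auto simp: normal_connection_mean_curvature)
    qed
    have dg: "dird X (gauss_map y) q = dird X \<nu> q" if "q \<in> W" for X q
      by (rule dird_W_cong[OF that nu smg])
    have "frame_laplacian y E\<^sub>1 E\<^sub>2 (gauss_map y) p = frame_laplacian y E\<^sub>1 E\<^sub>2 \<nu> p"
      unfolding frame_laplacian_frame[OF p smooth_nu] frame_laplacian_frame[OF p smg]
      using dird_W_cong[OF p dg smooth_dird(1)[OF smg]] dird_W_cong[OF p dg smooth_dird(2)[OF smg]] dg[OF p]
      by simp
    also have "\<dots> = (biv_inner (dird E\<^sub>1 \<nu> p) (dird E\<^sub>1 \<nu> p) + biv_inner (dird E\<^sub>2 \<nu> p) (dird E\<^sub>2 \<nu> p)) *\<^sub>R \<nu> p"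
      using laplacian_nu_parallel[OF N p] nz p W(2) by auto
    also have "\<dots> = gauss_energy y p *\<^sub>R gauss_map y p"
      using gauss_energy_eq[OF differentiable_y differentiable_gauss_map basis[OF p]] p W(2)
      unfolding nu[OF p] dg[OF p, symmetric] by (auto simp: dird_def)
    finally show ?thesis .
  qed
  show ?thesis
    unfolding has_laplacian_def
  proof (intro allI impI ballI, elim conjE)
    fix W E\<^sub>1 E\<^sub>2 p assume W: "open W" "W \<subseteq> V" and E: "orthonormal_frame y W E\<^sub>1 E\<^sub>2" and p: "p \<in> W"
    define \<delta> where "\<delta> q = det (vector [E\<^sub>1 q, E\<^sub>2 q] :: real^2^2)" for q
    have "smooth_on W E\<^sub>1" "smooth_on W E\<^sub>2" using E by (auto simp: orthonormal_frame_def)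
    then have "continuous_on W \<delta>"
      unfolding \<delta>_def det_2 vector_2
      by (intro continuous_intros smooth_on_imp_continuous_on)
    then have op: "open (W \<inter> \<delta> -` {0<..})" "open (W \<inter> \<delta> -` {..<0})"
      using continuous_open_preimage W(1) open_greaterThan open_lessThan by blast+
    have "\<delta> p \<noteq> 0"
      unfolding \<delta>_def using E p W(2)
      by (intro orthonormal_det[OF differentiable_y]) (auto simp: orthonormal_frame_def)
    then consider "\<delta> p > 0" | "\<delta> p < 0" by linarith
    then show "frame_laplacian y E\<^sub>1 E\<^sub>2 (gauss_map y) p = gauss_energy y p *\<^sub>R gauss_map y p"
    proof cases
      case 1
      have "orthonormal_frame y (W \<inter> \<delta> -` {0<..}) E\<^sub>1 E\<^sub>2"
        using E by (auto simp: orthonormal_frame_def intro: smooth_on_subset)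
      then show ?thesis
        using W p 1 by (intro oriented[OF op(1)]) (auto simp: \<delta>_def)
    next
      case 2
      have "orthonormal_frame y (W \<inter> \<delta> -` {..<0}) E\<^sub>2 E\<^sub>1"
        using E by (auto simp: orthonormal_frame_def orthonormal_basis_def first_form_commute intro: smooth_on_subset)
      moreover have "det (vector [E\<^sub>2 q, E\<^sub>1 q] :: real^2^2) = - \<delta> q" for q
        by (simp add: \<delta>_def det_2)
      ultimately have "frame_laplacian y E\<^sub>2 E\<^sub>1 (gauss_map y) p = gauss_energy y p *\<^sub>R gauss_map y p"
        using W p 2 by (intro oriented[OF op(2)]) auto
      then show ?thesis by (simp add: frame_laplacian_def add.commute)
    qed
  qed
qed

end

text \<open>The derivative of \<open>\<tau>\<close> maps positive orthonormal bases to positive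
  orthonormal bases, so the Gauss maps correspond on all of the open set \<open>T\<close>. The chain
  rule then identifies their first derivatives.\<close>

lemma gauss_energy_chart_change:
  assumes y: "spacelike_patch y V" and z: "spacelike_patch z V'"
    and T: "open T" "T \<subseteq> V" "\<tau> ` T \<subseteq> V'" and \<tau>: "smooth_on T \<tau>"
    and pos: "\<And>q. q \<in> T \<Longrightarrow> det (matrix (frechet_derivative \<tau> (at q))) > 0"
    and eq: "\<And>q. q \<in> T \<Longrightarrow> y q = z (\<tau> q)" and p: "p \<in> T"
  shows "gauss_energy y p = gauss_energy z (\<tau> p)"
proof -
  interpret y: spacelike_patch y V by (rule y)
  interpret z: spacelike_patch z V' by (rule z)
  have d\<tau>: "\<tau> differentiable at q" if "q \<in> T" for q
    using smooth_on_differentiable[OF \<tau> T(1) that] .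
  have chain: "frechet_derivative F (at q) v =
      frechet_derivative G (at (\<tau> q)) (frechet_derivative \<tau> (at q) v)"
    if "q \<in> T" "G differentiable at (\<tau> q)" "F differentiable at q" "\<And>q. q \<in> T \<Longrightarrow> F q = G (\<tau> q)"
    for F G :: "real^2 \<Rightarrow> 'b::real_normed_vector" and q v
  proof -
    have "frechet_derivative F (at q) = frechet_derivative (G \<circ> \<tau>) (at q)"
      by (rule frechet_derivative_transform_within_open[OF that(3) T(1) that(1)]) (simp add: that(4))
    then show ?thesis by (simp add: frechet_derivative_compose[OF d\<tau>[OF that(1)] that(2)])
  qed
  have mem: "q \<in> V" "\<tau> q \<in> V'" if "q \<in> T" for q using that T by auto
  have dyz: "frechet_derivative y (at q) v = frechet_derivative z (at (\<tau> q)) (frechet_derivative \<tau> (at q) v)"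
    if "q \<in> T" for q v
    by (rule chain[OF that z.differentiable_y[OF mem(2)[OF that]] y.differentiable_y[OF mem(1)[OF that]] eq])
  have basis: "orthonormal_basis z (\<tau> q) (frechet_derivative \<tau> (at q) u) (frechet_derivative \<tau> (at q) v)"
    if "q \<in> T" "orthonormal_basis y q u v" for q u v
    using that(2) by (simp add: orthonormal_basis_def first_form_def dyz[OF that(1)])
  obtain E\<^sub>1 E\<^sub>2 where E: "orthonormal_frame y V E\<^sub>1 E\<^sub>2"
    and Epos: "\<And>q. q \<in> V \<Longrightarrow> det (vector [E\<^sub>1 q, E\<^sub>2 q] :: real^2^2) > 0"
    using y.oriented_frame by blast
  have ob: "orthonormal_basis y q (E\<^sub>1 q) (E\<^sub>2 q)" if "q \<in> T" for q
    using E mem(1)[OF that] by (auto simp: orthonormal_frame_def)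
  have gauss: "gauss_map y q = gauss_map z (\<tau> q)" if q: "q \<in> T" for q
  proof -
    have "det (vector [frechet_derivative \<tau> (at q) (E\<^sub>1 q), frechet_derivative \<tau> (at q) (E\<^sub>2 q)] :: real^2^2) > 0"
      unfolding det_vector_matrix[OF linear_frechet_derivative[OF d\<tau>[OF q]]]
      using pos[OF q] Epos[OF mem(1)[OF q]] by simp
    from gauss_map_eq[OF z.differentiable_y[OF mem(2)[OF q]] basis[OF q ob[OF q]] this]
      gauss_map_eq[OF y.differentiable_y[OF mem(1)[OF q]] ob[OF q] Epos[OF mem(1)[OF q]]]
    show ?thesis by (simp add: dyz[OF q])
  qed
  note dg = y.differentiable_gauss_map[OF mem(1)[OF p]] z.differentiable_gauss_map[OF mem(2)[OF p]]
  show ?thesis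
    unfolding gauss_energy_eq[OF y.differentiable_y[OF mem(1)[OF p]] dg(1) ob[OF p]]
      gauss_energy_eq[OF z.differentiable_y[OF mem(2)[OF p]] dg(2) basis[OF p ob[OF p]]]
    by (simp add: chain[OF p dg(2,1) gauss])
qed

section \<open>Surfaces with an atlas\<close>

context
  fixes M :: "'a topology" and A :: "'a chart set" and x :: "'a \<Rightarrow> real^5"
  assumes surface: "spacelike_surface_in_de_sitter M A x"
begin

lemma chart_openin: "(U, \<phi>) \<in> A \<Longrightarrow> openin M U"
  and chart_open: "(U, \<phi>) \<in> A \<Longrightarrow> open (\<phi> ` U)"
  and chart_homeomorphic: "(U, \<phi>) \<in> A \<Longrightarrow> homeomorphic_map (subtopology M U) (top_of_set (\<phi> ` U)) \<phi>"
  using surface by (auto simp: spacelike_surface_in_de_sitter_def oriented_surface_def)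

lemma chart_inj_on:
  assumes "(U, \<phi>) \<in> A"
  shows "inj_on \<phi> U"
proof -
  have "topspace (subtopology M U) = U"
    using openin_subset[OF chart_openin[OF assms]] by auto
  then show ?thesis using homeomorphic_imp_injective_map[OF chart_homeomorphic[OF assms]] by simp
qed

lemma chart_overlap_open:
  assumes "(U, \<phi>) \<in> A" "(V, \<psi>) \<in> A"
  shows "open (\<phi> ` (U \<inter> V))"
proof -
  have "openin (subtopology M U) (U \<inter> V)"
    using chart_openin[OF assms(1)] chart_openin[OF assms(2)]
    by (simp add: openin_open_subtopology openin_Int)
  then have "openin (top_of_set (\<phi> ` U)) (\<phi> ` (U \<inter> V))"
    using homeomorphic_imp_open_map[OF chart_homeomorphic[OF assms(1)]] by (simp add: open_map_def)
  then show ?thesis using openin_open_eq[OF chart_open[OF assms(1)]] by blast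
qed

lemma chart_patch:
  assumes c: "(U, \<phi>) \<in> A"
  shows "spacelike_patch (x \<circ> inv_into U \<phi>) (\<phi> ` U)"
proof
  show "open (\<phi> ` U)" by (rule chart_open[OF c])
  show "smooth_on (\<phi> ` U) (x \<circ> inv_into U \<phi>)"
    using surface c by (auto simp: spacelike_surface_in_de_sitter_def smooth_map_def)
  show "mink ((x \<circ> inv_into U \<phi>) p) ((x \<circ> inv_into U \<phi>) p) = 1" if "p \<in> \<phi> ` U" for p
  proof -
    have "inv_into U \<phi> p \<in> topspace M"
      using inv_into_into[OF that] openin_subset[OF chart_openin[OF c]] by blast
    then show ?thesis using surface by (auto simp: spacelike_surface_in_de_sitter_def de_sitter_def)
  qed
  show "first_form (x \<circ> inv_into U \<phi>) p u u > 0" if "p \<in> \<phi> ` U" "u \<noteq> 0" for p u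
    using surface c that unfolding spacelike_surface_in_de_sitter_def by blast
qed

lemma gauss_energy_chart_independent:
  assumes c: "(U, \<phi>) \<in> A" "(V, \<psi>) \<in> A" and m: "m \<in> U \<inter> V"
  shows "gauss_energy (x \<circ> inv_into U \<phi>) (\<phi> m) = gauss_energy (x \<circ> inv_into V \<psi>) (\<psi> m)"
proof -
  let ?\<tau> = "\<psi> \<circ> inv_into U \<phi>" and ?T = "\<phi> ` (U \<inter> V)"
  have inv: "inv_into U \<phi> (\<phi> k) = k" "inv_into V \<psi> (\<psi> k) = k" if "k \<in> U \<inter> V" for k
    using that chart_inj_on[OF c(1)] chart_inj_on[OF c(2)] by auto
  have "gauss_energy (x \<circ> inv_into U \<phi>) (\<phi> m) = gauss_energy (x \<circ> inv_into V \<psi>) (?\<tau> (\<phi> m))"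
  proof (rule gauss_energy_chart_change[OF chart_patch[OF c(1)] chart_patch[OF c(2)] chart_overlap_open[OF c]])
    show "?\<tau> ` ?T \<subseteq> \<psi> ` V" using inv by auto
    have "\<forall>c\<in>A. \<forall>d\<in>A. smooth_on (snd c ` (fst c \<inter> fst d)) (snd d \<circ> inv_into (fst c) (snd c)) \<and>
        (\<forall>q\<in>snd c ` (fst c \<inter> fst d). det (matrix (frechet_derivative (snd d \<circ> inv_into (fst c) (snd c)) (at q))) > 0)"
      using surface by (simp add: spacelike_surface_in_de_sitter_def oriented_surface_def case_prod_unfold)
    from bspec[OF bspec[OF this c(1)] c(2)]
    show "smooth_on ?T ?\<tau>" "\<And>q. q \<in> ?T \<Longrightarrow> det (matrix (frechet_derivative ?\<tau> (at q))) > 0"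
      by auto
  qed (use m inv in auto)
  then show ?thesis using inv m by simp
qed

text \<open>The factor in the 1-type equation has to be a function on the surface itself, so an
  arbitrary chart around \<open>m\<close> is selected; chart independence makes the choice
  harmless.\<close>

definition energy :: "'a \<Rightarrow> real" where
  "energy m = (let (U, \<phi>) = (SOME c. c \<in> A \<and> m \<in> fst c) in gauss_energy (x \<circ> inv_into U \<phi>) (\<phi> m))"

lemma energy_eq:
  assumes c: "(U, \<phi>) \<in> A" and p: "p \<in> \<phi> ` U"
  shows "energy (inv_into U \<phi> p) = gauss_energy (x \<circ> inv_into U \<phi>) p"
proof -
  let ?m = "inv_into U \<phi> p"
  have m: "?m \<in> U" "\<phi> ?m = p" using p by (auto intro: inv_into_into f_inv_into_f)
  obtain V \<psi> where V: "(SOME c. c \<in> A \<and> ?m \<in> fst c) = (V, \<psi>)" by fastforce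
  have "(V, \<psi>) \<in> A \<and> ?m \<in> V"
    using someI[of "\<lambda>c. c \<in> A \<and> ?m \<in> fst c" "(U, \<phi>)"] c m unfolding V by simp
  then show ?thesis
    using gauss_energy_chart_independent[OF c, of V \<psi> ?m] m by (simp add: energy_def V)
qed

end

theorem corollary3p2:
  fixes M :: "'a topology" and A :: "'a chart set" and x :: "'a \<Rightarrow> real^5"
  assumes "spacelike_surface_in_de_sitter M A x"
    and "nonzero_mean_curvature A x"
  shows "pointwise_1_type_gauss_map A x \<longleftrightarrow> parallel_mean_curvature A x"
proof
  assume "pointwise_1_type_gauss_map A x"
  then obtain f :: "'a \<Rightarrow> real" and C where f: "smooth_map A f"
    and lap: "\<And>U \<phi>. (U, \<phi>) \<in> A \<Longrightarrow>
      has_laplacian (x \<circ> inv_into U \<phi>) (\<phi> ` U) (gauss_map (x \<circ> inv_into U \<phi>))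
        (\<lambda>p. f (inv_into U \<phi> p) *\<^sub>R (gauss_map (x \<circ> inv_into U \<phi>) p + C))"
    unfolding pointwise_1_type_gauss_map_def by fast
  show "parallel_mean_curvature A x"
    unfolding parallel_mean_curvature_def
  proof clarsimp
    fix U \<phi> X m assume c: "(U, \<phi>) \<in> A" and m: "m \<in> U"
    interpret spacelike_patch "x \<circ> inv_into U \<phi>" "\<phi> ` U" by (rule chart_patch[OF assms(1) c])
    have "smooth_on (\<phi> ` U) (f \<circ> inv_into U \<phi>)" using f c by (auto simp: smooth_map_def)
    then have "continuous_on (\<phi> ` U) (\<lambda>p. f (inv_into U \<phi> p))"
      using smooth_on_imp_continuous_on by (fastforce simp: o_def)
    from parallel_if_laplacian[OF lap[OF c] this] m
    show "normal_connection (x \<circ> inv_into U \<phi>) X (mean_curvature (x \<circ> inv_into U \<phi>)) (\<phi> m) = 0" by blast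
  qed
next
  assume par: "parallel_mean_curvature A x"
  let ?f = "energy A x"
  have "smooth_map A ?f"
    unfolding smooth_map_def
  proof clarify
    fix U \<phi> assume c: "(U, \<phi>) \<in> A"
    interpret spacelike_patch "x \<circ> inv_into U \<phi>" "\<phi> ` U" by (rule chart_patch[OF assms(1) c])
    show "smooth_on (\<phi> ` U) (?f \<circ> inv_into U \<phi>)"
      by (rule smooth_on_cong[OF open_V _ smooth_gauss_energy]) (simp add: energy_eq[OF assms(1) c])
  qed
  \<comment> \<open>The constant bivector of the 1-type equation is 0 in this direction.\<close>
  moreover have "has_laplacian (x \<circ> inv_into U \<phi>) (\<phi> ` U) (gauss_map (x \<circ> inv_into U \<phi>))
      (\<lambda>p. ?f (inv_into U \<phi> p) *\<^sub>R (gauss_map (x \<circ> inv_into U \<phi>) p + 0))" if c: "(U, \<phi>) \<in> A" for U \<phi>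
  proof -
    interpret spacelike_patch "x \<circ> inv_into U \<phi>" "\<phi> ` U" by (rule chart_patch[OF assms(1) c])
    have "has_laplacian (x \<circ> inv_into U \<phi>) (\<phi> ` U) (gauss_map (x \<circ> inv_into U \<phi>))
        (\<lambda>p. gauss_energy (x \<circ> inv_into U \<phi>) p *\<^sub>R gauss_map (x \<circ> inv_into U \<phi>) p)"
    proof (rule laplacian_if_parallel)
      show "normal_connection (x \<circ> inv_into U \<phi>) X (mean_curvature (x \<circ> inv_into U \<phi>)) p = 0"
        if "p \<in> \<phi> ` U" "smooth_on (\<phi> ` U) X" for X p
        using par c that unfolding parallel_mean_curvature_def by fast
      show "mean_curvature (x \<circ> inv_into U \<phi>) p \<noteq> 0" if "p \<in> \<phi> ` U" for p
        using assms(2) c that unfolding nonzero_mean_curvature_def by fast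
    qed
    moreover have "?f (inv_into U \<phi> p) = gauss_energy (x \<circ> inv_into U \<phi>) p" if "p \<in> \<phi> ` U" for p
      by (rule energy_eq[OF assms(1) c that])
    ultimately show ?thesis
      \<comment> \<open>The two factors agree only on the chart image, which is enough because all
        admissible \<open>W\<close> lie inside it.\<close>
      unfolding has_laplacian_def by (intro allI impI ballI) (simp add: subset_iff)
  qed
  moreover have "0 \<in> bivectors" by (simp add: bivectors_def transpose_def vec_eq_iff)
  ultimately show "pointwise_1_type_gauss_map A x"
    unfolding pointwise_1_type_gauss_map_def by (intro exI[of _ ?f] bexI[of _ 0]) auto
qed

end
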